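(* Let $(G,\tau)$ be a Hausdorff right topological group which is either $\sigma$-locally compact and admissible, or compact. If $G$ has a $\sigma\sigma$-closed, compact normal subgroup $H\subset\Lambda_b(G)$ such that $H$ is metrizable and has a right invariant Haar measure, then $G$ has a (right) Haar measure.
   Context: A right topological group is a group $G$ with a topology $\tau$ such that for every $x\in G$ the map $g\mapsto gx$ is continuous. Its topological center is $\Lambda(G)=\{x\in G : g\mapsto xg \text{ is continuous}\}$; $G$ is admissible if $\Lambda(G)$ is dense. Its Borel center is $\Lambda_b(G)=\{g\in G: x\mapsto gx\text{ is Borel}\}$. "$\sigma$-locally compact" means locally compact and $\sigma$-compact. The $\sigma$-topology on $G$ is the quotient topology on $G$ induced by $(G,\tau)\times(G,\tau)\to G$, $(x,y)\mapsto x^{-1}y$; the $\sigma\sigma$-topology is the quotient topology on $G$ induced by $(G,\sigma)\times(G,\sigma)\to G$, $(x,y)\mapsto x^{-1}y$. Compactness and metrizability of $H$ refer to the subspace topology from $\tau$. A (right invariant) Haar measure on a right topological group $K$ is a non-zero positive Radon measure $\lambda$ with $\lambda(Eg)=\lambda(E)$ for all $g\in K$ and Borel $E\subset K$ (normalized to be a probability measure when $K$ is compact). *)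

theory Defs
  imports "HOL-Analysis.Analysis" "HOL-Algebra.Coset"
begin

definition sigma_compact_space :: "'a topology \<Rightarrow> bool" where
  "sigma_compact_space X \<longleftrightarrow>
     (\<exists>K :: nat \<Rightarrow> 'a set. (\<forall>n. compactin X (K n)) \<and> topspace X = (\<Union>n. K n))"

definition sigma_locally_compact_space :: "'a topology \<Rightarrow> bool" where
  "sigma_locally_compact_space X \<longleftrightarrow> locally_compact_space X \<and> sigma_compact_space X"

definition quotient_topology :: "'a topology \<Rightarrow> ('a \<Rightarrow> 'b) \<Rightarrow> 'b topology" where
  "quotient_topology X f =
     topology (\<lambda>U. U \<subseteq> f ` topspace X \<and> openin X {x \<in> topspace X. f x \<in> U})"

lemma openin_quotient_topology:
  "openin (quotient_topology X f) U \<longleftrightarrow>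
     U \<subseteq> f ` topspace X \<and> openin X {x \<in> topspace X. f x \<in> U}"
proof -
  have "istopology (\<lambda>U. U \<subseteq> f ` topspace X \<and> openin X {x \<in> topspace X. f x \<in> U})"
    unfolding istopology_def
  proof (intro conjI allI impI)
    fix S T
    assume S: "S \<subseteq> f ` topspace X \<and> openin X {x \<in> topspace X. f x \<in> S}"
      and T: "T \<subseteq> f ` topspace X \<and> openin X {x \<in> topspace X. f x \<in> T}"
    show "S \<inter> T \<subseteq> f ` topspace X" using S by blast
    have "{x \<in> topspace X. f x \<in> S \<inter> T}
        = {x \<in> topspace X. f x \<in> S} \<inter> {x \<in> topspace X. f x \<in> T}" by blast
    then show "openin X {x \<in> topspace X. f x \<in> S \<inter> T}"
      using S T by (simp only: openin_Int)
  next
    fix \<K>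
    assume K: "\<forall>K\<in>\<K>. K \<subseteq> f ` topspace X \<and> openin X {x \<in> topspace X. f x \<in> K}"
    show "\<Union>\<K> \<subseteq> f ` topspace X" using K by blast
    have "{x \<in> topspace X. f x \<in> \<Union>\<K>} = (\<Union>K\<in>\<K>. {x \<in> topspace X. f x \<in> K})" by blast
    moreover have "openin X (\<Union>K\<in>\<K>. {x \<in> topspace X. f x \<in> K})"
      by (rule openin_Union) (use K in blast)
    ultimately show "openin X {x \<in> topspace X. f x \<in> \<Union>\<K>}" by (simp only:)
  qed
  then show ?thesis
    unfolding quotient_topology_def by (simp add: topology_inverse')
qed

lemma topspace_quotient_topology [simp]:
  "topspace (quotient_topology X f) = f ` topspace X"
proof
  show "topspace (quotient_topology X f) \<subseteq> f ` topspace X"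
    using openin_topspace[of "quotient_topology X f"] unfolding openin_quotient_topology by (rule conjunct1)
  have "{x \<in> topspace X. f x \<in> f ` topspace X} = topspace X" by blast
  then have "openin (quotient_topology X f) (f ` topspace X)"
    by (simp add: openin_quotient_topology)
  then show "f ` topspace X \<subseteq> topspace (quotient_topology X f)"
    by (rule openin_subset)
qed

lemma quotient_map_quotient_topology: "quotient_map X (quotient_topology X f) f"
  unfolding quotient_map_def by (auto simp: openin_quotient_topology)

definition borel_of :: "'a topology \<Rightarrow> 'a measure" where
  "borel_of X = sigma (topspace X) {U. openin X U}"

text \<open>For Hausdorff \<open>X\<close>, so that compact sets are Borel.  When \<open>X\<close> is locally compact and
  \<open>\<sigma>\<close>-compact this agrees with the other usual definition, a locally finite Borel measure that is
  inner regular with respect to compact sets on all Borel sets.\<close>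

definition radon_measure :: "'a topology \<Rightarrow> 'a measure \<Rightarrow> bool" where
  "radon_measure X M \<longleftrightarrow>
     space M = topspace X \<and> sets M = sets (borel_of X) \<and>
     (\<forall>K. compactin X K \<longrightarrow> emeasure M K < \<infinity>) \<and>
     (\<forall>E\<in>sets M. emeasure M E = (INF U\<in>{U. openin X U \<and> E \<subseteq> U}. emeasure M U)) \<and>
     (\<forall>U. openin X U \<longrightarrow> emeasure M U = (SUP K\<in>{K. compactin X K \<and> K \<subseteq> U}. emeasure M K))"

locale right_topological_group = group G for G (structure) +
  fixes T :: "'a topology"
  assumes topspace_eq_carrier: "topspace T = carrier G"
    and continuous_right_mult: "x \<in> carrier G \<Longrightarrow> continuous_map T T (\<lambda>g. g \<otimes> x)"

definition topological_center :: "('a, 'b) monoid_scheme \<Rightarrow> 'a topology \<Rightarrow> 'a set" where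
  "topological_center G T = {x \<in> carrier G. continuous_map T T (\<lambda>g. x \<otimes>\<^bsub>G\<^esub> g)}"

definition admissible :: "('a, 'b) monoid_scheme \<Rightarrow> 'a topology \<Rightarrow> bool" where
  "admissible G T \<longleftrightarrow> T closure_of (topological_center G T) = topspace T"

definition borel_center :: "('a, 'b) monoid_scheme \<Rightarrow> 'a topology \<Rightarrow> 'a set" where
  "borel_center G T = {g \<in> carrier G. (\<lambda>x. g \<otimes>\<^bsub>G\<^esub> x) \<in> borel_of T \<rightarrow>\<^sub>M borel_of T}"

definition sigma_topology :: "('a, 'b) monoid_scheme \<Rightarrow> 'a topology \<Rightarrow> 'a topology" where
  "sigma_topology G T =
     quotient_topology (prod_topology T T) (\<lambda>(x, y). inv\<^bsub>G\<^esub> x \<otimes>\<^bsub>G\<^esub> y)"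

definition sigma_sigma_topology :: "('a, 'b) monoid_scheme \<Rightarrow> 'a topology \<Rightarrow> 'a topology" where
  "sigma_sigma_topology G T = sigma_topology G (sigma_topology G T)"

definition right_haar_measure ::
  "('a, 'b) monoid_scheme \<Rightarrow> 'a topology \<Rightarrow> 'a measure \<Rightarrow> bool" where
  "right_haar_measure G T M \<longleftrightarrow>
     radon_measure T M \<and> emeasure M (space M) \<noteq> 0 \<and>
     (\<forall>g\<in>carrier G. \<forall>E\<in>sets M. emeasure M (E #>\<^bsub>G\<^esub> g) = emeasure M E) \<and>
     (compact_space T \<longrightarrow> emeasure M (space M) = 1)"

context right_topological_group
begin

lemma topspace_sigma_topology:
  assumes "topspace S = carrier G"
  shows "topspace (sigma_topology G S) = carrier G"
proof -
  have "(\<lambda>(x, y). inv x \<otimes> y) ` (carrier G \<times> carrier G) = carrier G" (is "?f ` _ = _")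
  proof
    show "carrier G \<subseteq> ?f ` (carrier G \<times> carrier G)"
    proof
      fix g assume g: "g \<in> carrier G"
      then have "g = ?f (\<one>, g)" by simp
      then show "g \<in> ?f ` (carrier G \<times> carrier G)" using g by blast
    qed
  qed auto
  then show ?thesis by (simp add: sigma_topology_def assms)
qed

lemma topspace_sigma_sigma_topology: "topspace (sigma_sigma_topology G T) = carrier G"
  by (simp add: sigma_sigma_topology_def topspace_sigma_topology topspace_eq_carrier)

lemma right_topological_group_subgroup:
  assumes "subgroup H G"
  shows "right_topological_group (G\<lparr>carrier := H\<rparr>) (subtopology T H)"
proof -
  interpret H: group "G\<lparr>carrier := H\<rparr>" using assms by (rule subgroup.subgroup_is_group) (rule is_group)
  have sub: "H \<subseteq> carrier G" using assms by (rule subgroup.subset)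
  show ?thesis
  proof
    show "topspace (subtopology T H) = carrier (G\<lparr>carrier := H\<rparr>)"
      using sub by (auto simp: topspace_eq_carrier)
    fix x assume "x \<in> carrier (G\<lparr>carrier := H\<rparr>)"
    then have x: "x \<in> H" by simp
    then have "continuous_map T T (\<lambda>g. g \<otimes> x)" using sub continuous_right_mult by blast
    moreover have "g \<otimes> x \<in> H" if "g \<in> H" for g
      using that x assms by (simp add: subgroup.m_closed)
    ultimately show "continuous_map (subtopology T H) (subtopology T H)
        (\<lambda>g. g \<otimes>\<^bsub>G\<lparr>carrier := H\<rparr>\<^esub> x)"
      by (auto simp: continuous_map_in_subtopology continuous_map_from_subtopology)
  qed
qed

end

end

theory Submission
  imports Defs
begin

text \<open>
  Since \<open>H\<close> is \<open>\<sigma>\<sigma>\<close>-closed, the topology induced on \<open>G/H\<close> by the \<open>\<sigma>\<close>-topology is Hausdorff; it is also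
  coarser than the quotient of \<open>\<tau>\<close> and locally compact, so a Baire category argument identifies the two
  and \<open>G/H\<close> is a locally compact topological group.  Another Baire category argument shows that
  \<open>\<pi> : G \<rightarrow> G/H\<close> is proper.  The Haar measure of \<open>G/H\<close> lifts to a Radon measure \<open>\<mu>\<close> on \<open>G\<close>, and by inner
  regularity \<open>\<mu>\<close> is right invariant on \<open>H\<close>-saturated Borel sets.

  Let \<open>\<lambda>\<close> be the Haar measure of \<open>H\<close>.  Because \<open>H\<close> is metrizable and contained in the Borel center,
  \<open>(x, h) \<mapsto> f (h x)\<close> is a Caratheodory function for continuous \<open>f\<close>, so \<open>(x, h) \<mapsto> h x\<close> is jointly measurable
  with respect to the Baire sets of \<open>G\<close>, and \<open>\<mu> \<otimes> \<lambda>\<close> can be pushed forward.  The image is right invariant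
  since \<open>x \<mapsto> \<lambda> {h. h x \<in> U}\<close> is constant on the cosets of \<open>H\<close>.  Its extension to a Radon measure on the
  Borel sets is the Haar measure of \<open>G\<close>.  Integrating over \<open>\<mu>\<close> rather than over \<open>G/H\<close> avoids having to show
  that an \<open>H\<close>-invariant Borel function on \<open>G\<close> is Borel on \<open>G/H\<close>.
\<close>

subsection \<open>Radon measures from contents\<close>

text \<open>Two obstacles shape the proof. First, \<open>(x, y) \<mapsto> inv x \<otimes> y\<close>
  is continuous from \<tau> \<times> \<tau> only into \<sigma>, so \<open>G Mod H\<close> becomes a
  topological group only once its quotient topologies from \<tau> and from \<sigma> are known to
  coincide. Closedness of \<open>H\<close> in \<sigma> makes the first of them Hausdorff, closedness
  in \<sigma>\<sigma> the second; admissibility or compactness makes the second locally compact.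
  Second, \<open>h \<otimes> x\<close> is Borel in \<open>x\<close> and continuous in
  \<open>h\<close>. This gives joint measurability after composition with a continuous real
  function, but not for preimages of arbitrary open sets of \<open>T\<close>, which need not be
  determined by a single such function. The push-forward is therefore evaluated only on cozero sets
  and the Radon measure is recovered from a content. Every Radon measure built from scratch arises
  from a content on compact sets: a limit of covering ratios on \<open>G Mod H\<close>, a finitely
  additive lift to \<open>G\<close>, and finally an infimum over cozero neighbourhoods.\<close>

lemma space_borel_of [simp]: "space (borel_of X) = topspace X"
  unfolding borel_of_def by (intro space_measure_of) (auto dest: openin_subset)

lemma sets_borel_of: "sets (borel_of X) = sigma_sets (topspace X) {U. openin X U}"
  unfolding borel_of_def by (intro sets_measure_of) (auto dest: openin_subset)

lemma openin_sets_borel_of: "openin X U \<Longrightarrow> U \<in> sets (borel_of X)"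
  by (simp add: sets_borel_of)

lemma closedin_sets_borel_of:
  assumes "closedin X C" shows "C \<in> sets (borel_of X)"
proof -
  have "topspace X - (topspace X - C) = C"
    using closedin_subset[OF assms] by blast
  then show ?thesis
    using sets.compl_sets[OF openin_sets_borel_of, of X "topspace X - C"] assms by auto
qed

lemma compactin_sets_borel_of:
  "Hausdorff_space X \<Longrightarrow> compactin X K \<Longrightarrow> K \<in> sets (borel_of X)"
  by (intro closedin_sets_borel_of compactin_imp_closedin)

lemma measurable_borel_of_openin:
  assumes "f \<in> space M \<rightarrow> topspace X" "\<And>U. openin X U \<Longrightarrow> f -` U \<inter> space M \<in> sets M"
  shows "f \<in> measurable M (borel_of X)"
  unfolding borel_of_def
  using assms by (intro measurable_measure_of) (auto dest: openin_subset)

lemma measurable_continuous_map: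
  assumes "continuous_map X Y f" shows "f \<in> measurable (borel_of X) (borel_of Y)"
proof (rule measurable_borel_of_openin)
  fix U assume "openin Y U"
  then have "openin X {x \<in> topspace X. f x \<in> U}"
    using assms by (simp add: continuous_map_def)
  moreover have "{x \<in> topspace X. f x \<in> U} = f -` U \<inter> space (borel_of X)"
    by auto
  ultimately show "f -` U \<inter> space (borel_of X) \<in> sets (borel_of X)"
    by (metis openin_sets_borel_of)
qed (use assms in \<open>auto simp: continuous_map_def\<close>)

text \<open>\<open>K - U\<close> and \<open>K - V\<close> are disjoint compact sets; removing
  disjoint open neighbourhoods of them from \<open>K\<close> leaves the two pieces. This is what
  makes \<open>inner_content\<close> subadditive.\<close>

lemma compactin_subset_Un_openin:
  assumes X: "Hausdorff_space X" and K: "compactin X K" and U: "openin X U" and V: "openin X V"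
    and KUV: "K \<subseteq> U \<union> V"
  obtains A B where "compactin X A" "compactin X B" "A \<subseteq> U" "B \<subseteq> V" "K = A \<union> B"
proof -
  have diff: "compactin X (K - W)" if "openin X W" for W
  proof -
    have "compactin X ((topspace X - W) \<inter> K)"
      using that K by (intro closed_Int_compactin) auto
    moreover have "(topspace X - W) \<inter> K = K - W"
      using compactin_subset_topspace[OF K] by auto
    ultimately show ?thesis by simp
  qed
  have "disjnt (K - U) (K - V)"
    using KUV by (auto simp: disjnt_def)
  then obtain C D where *: "openin X C" "openin X D" "K - U \<subseteq> C" "K - V \<subseteq> D" "disjnt C D"
    using Hausdorff_space_compact_separation[OF X diff[OF U] diff[OF V]] by metis
  show thesis
  proof
    show "compactin X (K - C)" "compactin X (K - D)" using * diff by auto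
  qed (use * in \<open>auto simp: disjnt_iff\<close>)
qed

text \<open>No regularity of \<open>\<kappa>\<close> is demanded, so that cluster points of set
  functions qualify. The price is that the resulting measure need not extend
  \<open>\<kappa>\<close>: on a compact set it is only known to be at least \<open>\<kappa>\<close>,
  and at most the value of \<open>\<kappa>\<close> on a compact neighbourhood.\<close>

locale compact_content =
  fixes X :: "'a topology" and \<kappa> :: "'a set \<Rightarrow> ennreal"
  assumes Hausdorff: "Hausdorff_space X"
    and locally_compact: "locally_compact_space X"
    and content_finite: "compactin X K \<Longrightarrow> \<kappa> K < \<infinity>"
    and content_mono: "compactin X K \<Longrightarrow> compactin X L \<Longrightarrow> K \<subseteq> L \<Longrightarrow> \<kappa> K \<le> \<kappa> L"
    and content_subadd: "compactin X K \<Longrightarrow> compactin X L \<Longrightarrow> \<kappa> (K \<union> L) \<le> \<kappa> K + \<kappa> L"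
    and content_superadd:
      "compactin X K \<Longrightarrow> compactin X L \<Longrightarrow> disjnt K L \<Longrightarrow> \<kappa> K + \<kappa> L \<le> \<kappa> (K \<union> L)"
begin

definition inner_content :: "'a set \<Rightarrow> ennreal" where
  "inner_content U = (SUP K\<in>{K. compactin X K \<and> K \<subseteq> U}. \<kappa> K)"

definition outer_content :: "'a set \<Rightarrow> ennreal" where
  "outer_content A = (INF U\<in>{U. openin X U \<and> A \<subseteq> U}. inner_content U)"

lemma content_empty: "\<kappa> {} = 0"
proof -
  have "\<kappa> {} + \<kappa> {} \<le> \<kappa> {}" "\<kappa> {} \<noteq> \<infinity>"
    using content_superadd[of "{}" "{}"] content_finite[of "{}"] by auto
  then have "\<kappa> {} + \<kappa> {} \<le> \<kappa> {} + 0" by simp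
  then show ?thesis
    using \<open>\<kappa> {} \<noteq> \<infinity>\<close> by (subst (asm) ennreal_add_left_cancel_le) auto
qed

lemma content_le_inner: "compactin X K \<Longrightarrow> K \<subseteq> U \<Longrightarrow> \<kappa> K \<le> inner_content U"
  unfolding inner_content_def by (intro SUP_upper) auto

lemma inner_content_least:
  "(\<And>K. compactin X K \<Longrightarrow> K \<subseteq> U \<Longrightarrow> \<kappa> K \<le> c) \<Longrightarrow> inner_content U \<le> c"
  unfolding inner_content_def by (intro SUP_least) auto

lemma inner_content_mono: "U \<subseteq> V \<Longrightarrow> inner_content U \<le> inner_content V"
  by (intro inner_content_least content_le_inner) auto

lemma inner_content_empty: "inner_content {} = 0"
proof -
  have "inner_content {} \<le> 0"
    by (intro inner_content_least) (auto simp: content_empty)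
  then show ?thesis by simp
qed

lemma inner_content_Un:
  assumes "openin X U" "openin X V"
  shows "inner_content (U \<union> V) \<le> inner_content U + inner_content V"
proof (rule inner_content_least)
  fix K assume "compactin X K" "K \<subseteq> U \<union> V"
  then obtain A B where *: "compactin X A" "compactin X B" "A \<subseteq> U" "B \<subseteq> V" "K = A \<union> B"
    using compactin_subset_Un_openin[OF Hausdorff] assms by metis
  then have "\<kappa> K \<le> \<kappa> A + \<kappa> B" using content_subadd by simp
  also have "\<dots> \<le> inner_content U + inner_content V"
    using * by (intro add_mono content_le_inner)
  finally show "\<kappa> K \<le> inner_content U + inner_content V" .
qed

lemma inner_content_UN:
  fixes U :: "nat \<Rightarrow> 'a set"
  assumes U: "\<And>n. openin X (U n)"
  shows "inner_content (\<Union>n. U n) \<le> (\<Sum>n. inner_content (U n))"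
proof (rule inner_content_least)
  fix K assume K: "compactin X K" "K \<subseteq> (\<Union>n. U n)"
  then obtain \<F> where F: "finite \<F>" "\<F> \<subseteq> range U" "K \<subseteq> \<Union>\<F>"
    using compactinD[OF K(1), of "range U"] U by auto
  then obtain I where I: "finite I" "\<F> = U ` I"
    by (meson finite_subset_image)
  have "inner_content (\<Union>n\<in>I. U n) \<le> (\<Sum>n\<in>I. inner_content (U n))" using I(1)
  proof (induction I)
    case (insert i I)
    have "openin X (\<Union>n\<in>I. U n)" using U by auto
    then have "inner_content (U i \<union> (\<Union>n\<in>I. U n)) \<le> inner_content (U i) + inner_content (\<Union>n\<in>I. U n)"
      by (intro inner_content_Un U)
    also have "\<dots> \<le> inner_content (U i) + (\<Sum>n\<in>I. inner_content (U n))"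
      by (intro add_left_mono insert.IH)
    finally show ?case using insert by simp
  qed (simp add: inner_content_empty)
  moreover have "\<kappa> K \<le> inner_content (\<Union>n\<in>I. U n)"
    using K(1) F(3) I(2) by (intro content_le_inner) auto
  moreover have "(\<Sum>n\<in>I. inner_content (U n)) \<le> (\<Sum>n. inner_content (U n))"
    using I(1) by (intro sum_le_suminf) auto
  ultimately show "\<kappa> K \<le> (\<Sum>n. inner_content (U n))" by order
qed

lemma outer_content_open: "openin X U \<Longrightarrow> outer_content U = inner_content U"
  unfolding outer_content_def
  by (intro antisym INF_lower INF_greatest inner_content_mono) auto

lemma outer_content_le: "openin X U \<Longrightarrow> A \<subseteq> U \<Longrightarrow> outer_content A \<le> inner_content U"
  unfolding outer_content_def by (intro INF_lower) auto

lemma outer_content_mono: "A \<subseteq> B \<Longrightarrow> outer_content A \<le> outer_content B"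
  unfolding outer_content_def by (intro INF_superset_mono) auto

lemma content_le_outer: "compactin X K \<Longrightarrow> \<kappa> K \<le> outer_content K"
  unfolding outer_content_def by (intro INF_greatest content_le_inner) auto

lemma outer_measure_space_outer_content: "outer_measure_space (Pow (topspace X)) outer_content"
  unfolding outer_measure_space_def
proof (intro conjI)
  show "positive (Pow (topspace X)) outer_content"
    by (simp add: positive_def outer_content_open inner_content_empty)
  show "increasing (Pow (topspace X)) outer_content"
    by (simp add: increasing_def outer_content_mono)
  show "countably_subadditive (Pow (topspace X)) outer_content"
  proof (simp add: countably_subadditive_def, safe)
    fix A :: "nat \<Rightarrow> 'a set"
    show "outer_content (\<Union>i. A i) \<le> (\<Sum>n. outer_content (A n))"
    proof (rule ennreal_le_epsilon)
      fix e :: real assume e: "0 < e" and fin: "(\<Sum>n. outer_content (A n)) < top_class.top"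
      have "\<exists>U. openin X U \<and> A n \<subseteq> U \<and> inner_content U \<le> outer_content (A n) + e * (1/2)^Suc n" for n
      proof -
        have "outer_content (A n) < outer_content (A n) + e * (1/2)^Suc n"
          using fin e by (auto simp add: less_top dest!: ennreal_suminf_lessD)
        then show ?thesis
          unfolding outer_content_def[of "A n"] INF_less_iff by (auto intro: less_imp_le)
      qed
      then obtain U where U: "\<And>n. openin X (U n)" "\<And>n. A n \<subseteq> U n"
        and le: "\<And>n. inner_content (U n) \<le> outer_content (A n) + e * (1/2)^Suc n"
        by metis
      have "outer_content (\<Union>i. A i) \<le> inner_content (\<Union>n. U n)"
        using U by (intro outer_content_le) auto
      also have "\<dots> \<le> (\<Sum>n. inner_content (U n))"
        by (intro inner_content_UN U)
      also have "\<dots> \<le> (\<Sum>n. outer_content (A n) + e * (1/2) ^ Suc n)"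
        by (intro suminf_le le) auto
      also have "\<dots> = (\<Sum>n. outer_content (A n)) + (\<Sum>n. ennreal e * ennreal ((1/2) ^ Suc n))"
        using e by (subst suminf_add[symmetric])
          (auto simp del: ennreal_suminf_cmult simp add: ennreal_mult[symmetric])
      also have "\<dots> = (\<Sum>n. outer_content (A n)) + e"
        unfolding ennreal_suminf_cmult
        by (subst suminf_ennreal_eq[OF zero_le_power power_half_series]) auto
      finally show "outer_content (\<Union>i. A i) \<le> (\<Sum>n. outer_content (A n)) + e" .
    qed
  qed
qed

text \<open>Exhaust \<open>V \<inter> U\<close> by compact \<open>K\<close>, then the open set
  \<open>V - K\<close>, which contains \<open>V - U\<close>, by compact \<open>L\<close>. Such
  \<open>K\<close> and \<open>L\<close> are disjoint, so superadditivity of \<open>\<kappa>\<close>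
  bounds the sum.\<close>

lemma openin_superadditive:
  assumes U: "openin X U" and V: "openin X V"
  shows "outer_content (V \<inter> U) + outer_content (V - U) \<le> inner_content V"
proof -
  have *: "\<kappa> K + outer_content (V - U) \<le> inner_content V" if K: "compactin X K" "K \<subseteq> V \<inter> U" for K
  proof -
    have op: "openin X (V - K)"
      using V compactin_imp_closedin[OF Hausdorff K(1)] by blast
    have "outer_content (V - U) \<le> inner_content (V - K)"
      using K by (intro outer_content_le op) auto
    moreover have "\<kappa> K + inner_content (V - K) \<le> inner_content V"
      unfolding inner_content_def[of "V - K"]
    proof (subst ennreal_SUP_add_right)
      show "(SUP L\<in>{L. compactin X L \<and> L \<subseteq> V - K}. \<kappa> K + \<kappa> L) \<le> inner_content V"
      proof (intro SUP_least)
        fix L assume L: "L \<in> {L. compactin X L \<and> L \<subseteq> V - K}"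
        then have "\<kappa> K + \<kappa> L \<le> \<kappa> (K \<union> L)"
          using K by (intro content_superadd) (auto simp: disjnt_def)
        also have "\<dots> \<le> inner_content V"
          using K L by (intro content_le_inner compactin_Un) auto
        finally show "\<kappa> K + \<kappa> L \<le> inner_content V" .
      qed
    qed auto
    ultimately show ?thesis
      by (meson add_left_mono order_trans)
  qed
  have "inner_content (V \<inter> U) + outer_content (V - U) \<le> inner_content V"
    unfolding inner_content_def[of "V \<inter> U"]
    by (subst ennreal_SUP_add_left[symmetric]) (auto intro!: SUP_least *)
  then show ?thesis
    using U V by (simp add: outer_content_open openin_Int)
qed

text \<open>Caratheodory's condition for an arbitrary test set \<open>A\<close> reduces to open test
  sets, because \<open>outer_content A\<close> is an infimum over open supersets.\<close>

lemma openin_lambda_system: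
  assumes U: "openin X U"
  shows "U \<in> lambda_system (topspace X) (Pow (topspace X)) outer_content"
proof -
  interpret sigma_algebra "topspace X" "Pow (topspace X)" by (rule sigma_algebra_Pow)
  have "outer_content (A \<inter> U) + outer_content (A - U) = outer_content A"
    if A: "A \<subseteq> topspace X" for A
  proof (rule antisym)
    show "outer_content (A \<inter> U) + outer_content (A - U) \<le> outer_content A"
      unfolding outer_content_def[of A]
    proof (intro INF_greatest)
      fix V assume V: "V \<in> {U. openin X U \<and> A \<subseteq> U}"
      have "outer_content (A \<inter> U) + outer_content (A - U)
          \<le> outer_content (V \<inter> U) + outer_content (V - U)"
        using V by (intro add_mono outer_content_mono) auto
      also have "\<dots> \<le> inner_content V"
        using V U by (intro openin_superadditive) auto
      finally show "outer_content (A \<inter> U) + outer_content (A - U) \<le> inner_content V" .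
    qed
    have pos: "positive (Pow (topspace X)) outer_content"
      and "countably_subadditive (Pow (topspace X)) outer_content"
      using outer_measure_space_outer_content by (auto simp: outer_measure_space_def)
    then have "subadditive (Pow (topspace X)) outer_content"
      by (intro countably_subadditive_subadditive)
    from subadditiveD[OF this, of "A \<inter> U" "A - U"]
    have "outer_content ((A \<inter> U) \<union> (A - U)) \<le> outer_content (A \<inter> U) + outer_content (A - U)"
      using A by auto
    moreover have "(A \<inter> U) \<union> (A - U) = A" by blast
    ultimately show "outer_content A \<le> outer_content (A \<inter> U) + outer_content (A - U)" by simp
  qed
  then show ?thesis
    using openin_subset[OF U] by (auto simp: lambda_system_eq)
qed

definition content_measure :: "'a measure" where
  "content_measure = measure_of (topspace X) {U. openin X U} outer_content"

lemma space_content_measure: "space content_measure = topspace X"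
  unfolding content_measure_def by (intro space_measure_of) (auto dest: openin_subset)

lemma sets_content_measure: "sets content_measure = sets (borel_of X)"
  unfolding content_measure_def sets_borel_of by (intro sets_measure_of) (auto dest: openin_subset)

lemma emeasure_content_measure:
  assumes "A \<in> sets (borel_of X)"
  shows "emeasure content_measure A = outer_content A"
proof -
  let ?L = "lambda_system (topspace X) (Pow (topspace X)) outer_content"
  have L: "measure_space (topspace X) ?L outer_content"
    using sigma_algebra.caratheodory_lemma[OF sigma_algebra_Pow outer_measure_space_outer_content] .
  then have sa: "sigma_algebra (topspace X) ?L" by (simp add: measure_space_def)
  have "sigma_sets (topspace X) {U. openin X U} \<subseteq> ?L"
    by (intro sigma_algebra.sigma_sets_subset[OF sa]) (auto intro: openin_lambda_system)
  then have "measure_space (topspace X) (sigma_sets (topspace X) {U. openin X U}) outer_content"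
    by (intro measure_down[OF L] sigma_algebra_sigma_sets) (auto dest: openin_subset)
  then have "positive (sets content_measure) outer_content"
    "countably_additive (sets content_measure) outer_content"
    by (simp_all add: sets_content_measure sets_borel_of measure_space_def)
  then show ?thesis
    using assms
    by (intro emeasure_measure_of[OF content_measure_def])
       (auto simp: sets_content_measure dest: openin_subset)
qed

lemma emeasure_content_measure_open:
  "openin X U \<Longrightarrow> emeasure content_measure U = (SUP K\<in>{K. compactin X K \<and> K \<subseteq> U}. \<kappa> K)"
  by (simp add: emeasure_content_measure openin_sets_borel_of outer_content_open inner_content_def)

lemma content_le_emeasure: "compactin X K \<Longrightarrow> \<kappa> K \<le> emeasure content_measure K"
  by (simp add: emeasure_content_measure compactin_sets_borel_of Hausdorff content_le_outer)

lemma compactin_subset_openin_compactin: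
  assumes K: "compactin X K"
  obtains U C where "openin X U" "compactin X C" "K \<subseteq> U" "U \<subseteq> C"
proof -
  have "locally_compact_space X \<Longrightarrow> \<exists>U C. openin X U \<and> compactin X C \<and> K \<subseteq> U \<and> U \<subseteq> C"
    using K locally_compact_space_compact_closed_compact[of X] Hausdorff by metis
  then show thesis using that locally_compact by metis
qed

lemma radon_measure_content_measure: "radon_measure X content_measure"
  unfolding radon_measure_def
proof (intro conjI allI impI ballI)
  show "space content_measure = topspace X" "sets content_measure = sets (borel_of X)"
    by (rule space_content_measure sets_content_measure)+
  fix K assume K: "compactin X K"
  \<comment> \<open>\<open>\<kappa> K\<close> bounds the measure of \<open>K\<close> only from
    below; finiteness comes from a compact neighbourhood.\<close>
  obtain U C where *: "openin X U" "compactin X C" "K \<subseteq> U" "U \<subseteq> C"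
    using compactin_subset_openin_compactin[OF K] .
  have "emeasure content_measure K = outer_content K"
    using K Hausdorff by (intro emeasure_content_measure compactin_sets_borel_of)
  also have "\<dots> \<le> inner_content U"
    using * by (intro outer_content_le)
  also have "\<dots> \<le> \<kappa> C"
    using * by (intro inner_content_least content_mono) auto
  also have "\<dots> < \<infinity>"
    using * by (intro content_finite)
  finally show "emeasure content_measure K < \<infinity>" .
next
  fix E assume "E \<in> sets content_measure"
  then have "emeasure content_measure E = outer_content E"
    by (intro emeasure_content_measure) (simp add: sets_content_measure)
  then show "emeasure content_measure E = (INF U\<in>{U. openin X U \<and> E \<subseteq> U}. emeasure content_measure U)"
    unfolding outer_content_def
    by (simp add: emeasure_content_measure_open inner_content_def cong: INF_cong_simp)
next
  fix U assume U: "openin X U"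
  show "emeasure content_measure U = (SUP K\<in>{K. compactin X K \<and> K \<subseteq> U}. emeasure content_measure K)"
  proof (rule antisym)
    show "emeasure content_measure U \<le> (SUP K\<in>{K. compactin X K \<and> K \<subseteq> U}. emeasure content_measure K)"
      unfolding emeasure_content_measure_open[OF U]
      by (intro SUP_mono) (auto intro: content_le_emeasure)
    show "(SUP K\<in>{K. compactin X K \<and> K \<subseteq> U}. emeasure content_measure K) \<le> emeasure content_measure U"
      using U by (intro SUP_least emeasure_mono)
        (auto simp: sets_content_measure openin_sets_borel_of)
  qed
qed

end

subsection \<open>Haar measure on locally compact topological groups\<close>

context right_topological_group
begin

lemma r_coset_eq_image: "A #> g = (\<lambda>x. x \<otimes> g) ` A"
  by (auto simp: r_coset_def)

text \<open>As the preimage of \<open>A\<close> under a continuous map, a translate inherits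
  openness and Borel measurability from \<open>A\<close>.\<close>

lemma r_coset_eq_preimage:
  assumes "A \<subseteq> carrier G" "g \<in> carrier G"
  shows "A #> g = {x \<in> carrier G. x \<otimes> inv g \<in> A}"
proof -
  have "(x \<otimes> inv g) \<otimes> g = x" "(x \<otimes> g) \<otimes> inv g = x" if "x \<in> carrier G" for x
    using that assms by (simp_all add: m_assoc)
  note * = this
  show ?thesis
  proof (intro equalityI subsetI)
    fix x assume "x \<in> A #> g"
    then show "x \<in> {x \<in> carrier G. x \<otimes> inv g \<in> A}"
      using assms * by (auto simp: r_coset_def)
  next
    fix x assume "x \<in> {x \<in> carrier G. x \<otimes> inv g \<in> A}"
    then have "x \<in> carrier G" "x \<otimes> inv g \<in> A" by auto
    then show "x \<in> A #> g"
      using *(1)[of x] unfolding r_coset_def by (metis UN_I singletonI)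
  qed
qed

lemma r_coset_inv_cancel:
  assumes "A \<subseteq> carrier G" "g \<in> carrier G"
  shows "(A #> g) #> inv g = A" "(A #> inv g) #> g = A"
  using assms by (simp_all add: coset_mult_assoc)

lemma openin_r_coset:
  assumes "openin T U" "g \<in> carrier G" shows "openin T (U #> g)"
proof -
  have "openin T {x \<in> topspace T. x \<otimes> inv g \<in> U}"
    using continuous_right_mult[of "inv g"] assms by (auto simp: continuous_map_def)
  then show ?thesis
    using assms openin_subset[of T U] by (simp add: r_coset_eq_preimage topspace_eq_carrier)
qed

lemma compactin_r_coset: "compactin T K \<Longrightarrow> g \<in> carrier G \<Longrightarrow> compactin T (K #> g)"
  unfolding r_coset_eq_image by (rule image_compactin) (auto intro: continuous_right_mult)

lemma sets_borel_of_r_coset: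
  assumes "E \<in> sets (borel_of T)" "g \<in> carrier G" shows "E #> g \<in> sets (borel_of T)"
proof -
  have "continuous_map T T (\<lambda>x. x \<otimes> inv g)"
    using assms(2) by (intro continuous_right_mult) simp
  then have "(\<lambda>x. x \<otimes> inv g) -` E \<inter> space (borel_of T) \<in> sets (borel_of T)"
    using assms(1) by (rule measurable_sets[OF measurable_continuous_map])
  moreover have "(\<lambda>x. x \<otimes> inv g) -` E \<inter> space (borel_of T) = E #> g"
    using assms sets.sets_into_space[of E "borel_of T"]
    by (auto simp: r_coset_eq_preimage topspace_eq_carrier)
  ultimately show ?thesis by simp
qed

end

locale right_invariant_content = right_topological_group G T + compact_content T \<kappa>
  for G (structure) and T :: "'a topology" and \<kappa> :: "'a set \<Rightarrow> ennreal" +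
  assumes content_r_coset: "compactin T K \<Longrightarrow> g \<in> carrier G \<Longrightarrow> \<kappa> (K #> g) = \<kappa> K"
begin

text \<open>Open supersets of \<open>E\<close> are translated by \<open>g\<close>, compact subsets
  of the translate back by \<open>inv g\<close>. The converse inequality is the same statement for
  \<open>inv g\<close>.\<close>

lemma outer_content_r_coset_le:
  assumes g: "g \<in> carrier G" shows "outer_content (E #> g) \<le> outer_content E"
  unfolding outer_content_def[of E]
proof (rule INF_greatest)
  fix U assume "U \<in> {U. openin T U \<and> E \<subseteq> U}"
  then have U: "openin T U" "E \<subseteq> U" "U \<subseteq> carrier G"
    by (auto simp flip: topspace_eq_carrier dest: openin_subset)
  have "outer_content (E #> g) \<le> inner_content (U #> g)"
    using U g by (intro outer_content_le openin_r_coset) (auto simp: r_coset_def)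
  also have "\<dots> \<le> inner_content U"
  proof (rule inner_content_least)
    fix K assume K: "compactin T K" "K \<subseteq> U #> g"
    have "K #> inv g \<subseteq> (U #> g) #> inv g"
      using K by (auto simp: r_coset_def)
    then have "\<kappa> (K #> inv g) \<le> inner_content U"
      using U g K by (intro content_le_inner compactin_r_coset) (auto simp: r_coset_inv_cancel)
    then show "\<kappa> K \<le> inner_content U"
      using K g by (simp add: content_r_coset)
  qed
  finally show "outer_content (E #> g) \<le> inner_content U" .
qed

lemma emeasure_content_measure_r_coset:
  assumes E: "E \<in> sets content_measure" and g: "g \<in> carrier G"
  shows "emeasure content_measure (E #> g) = emeasure content_measure E"
proof -
  have B: "E \<in> sets (borel_of T)"
    using E by (simp add: sets_content_measure)
  then have "E \<subseteq> carrier G"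
    using sets.sets_into_space topspace_eq_carrier by fastforce
  then have "outer_content E \<le> outer_content (E #> g)"
    using outer_content_r_coset_le[of "inv g" "E #> g"] g by (simp add: r_coset_inv_cancel)
  then show ?thesis
    using B g by (simp add: emeasure_content_measure sets_borel_of_r_coset
      antisym outer_content_r_coset_le)
qed

end

text \<open>By Tychonoff, since \<open>ennreal\<close> is compact; hence the functions need no bound
  in advance. Any closed relation between finitely many coordinates that holds eventually passes to
  \<open>\<phi>\<close>.\<close>

lemma ennreal_fun_cluster_point:
  fixes \<psi> :: "'u \<Rightarrow> 'i \<Rightarrow> ennreal"
  assumes F: "F \<noteq> bot"
  obtains \<phi> where "\<And>C. closed C \<Longrightarrow> (\<forall>\<^sub>F u in F. \<psi> u \<in> C) \<Longrightarrow> \<phi> \<in> C"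
proof -
  have "compact_space (product_topology (\<lambda>i. euclidean :: ennreal topology) (UNIV :: 'i set))"
    using Extended_Real_Limits.compact_UNIV[where 'a = ennreal]
    by (subst compact_space_product_topology) (simp add: compact_space_def)
  then have "compact (UNIV :: ('i \<Rightarrow> ennreal) set)"
    by (simp add: euclidean_product_topology compact_space_def)
  moreover have "filtermap \<psi> F \<noteq> bot"
    using F by (simp add: filtermap_bot_iff)
  ultimately obtain \<phi> where \<phi>: "inf (nhds \<phi>) (filtermap \<psi> F) \<noteq> bot"
    unfolding compact_filter by (metis UNIV_I always_eventually)
  show thesis
  proof (rule that, rule ccontr)
    fix C assume C: "closed C" "\<forall>\<^sub>F u in F. \<psi> u \<in> C" "\<phi> \<notin> C"
    then have "\<forall>\<^sub>F x in nhds \<phi>. x \<in> - C"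
      by (intro eventually_nhds_in_open) auto
    moreover have "\<forall>\<^sub>F x in filtermap \<psi> F. x \<in> C"
      using C(2) by (simp add: eventually_filtermap)
    ultimately have "\<forall>\<^sub>F x in inf (nhds \<phi>) (filtermap \<psi> F). False"
      unfolding eventually_inf by (intro exI conjI) auto
    then show False
      using \<phi> by (simp add: eventually_False)
  qed
qed

section \<open>Haar's covering numbers\<close>

locale locally_compact_topological_group = right_topological_group +
  assumes Hausdorff: "Hausdorff_space T"
    and locally_compact: "locally_compact_space T"
    and continuous_inv_mult: "continuous_map (prod_topology T T) T (\<lambda>(x, y). inv x \<otimes> y)"
begin

text \<open>Haar's index (K : U), taken with right translates because right invariance is
  wanted.\<close>

definition covering_number :: "'a set \<Rightarrow> 'a set \<Rightarrow> nat" where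
  "covering_number K U = Inf (card ` {F. finite F \<and> F \<subseteq> carrier G \<and> K \<subseteq> (\<Union>g\<in>F. U #> g)})"

lemma covering_number_le:
  "finite F \<Longrightarrow> F \<subseteq> carrier G \<Longrightarrow> K \<subseteq> (\<Union>g\<in>F. U #> g) \<Longrightarrow> covering_number K U \<le> card F"
  unfolding covering_number_def by (intro cInf_lower) auto

lemma covering_number_attained:
  assumes K: "compactin T K" and U: "openin T U" "U \<noteq> {}"
  obtains F where "finite F" "F \<subseteq> carrier G" "K \<subseteq> (\<Union>g\<in>F. U #> g)" "card F = covering_number K U"
proof -
  obtain u where u: "u \<in> U" "u \<in> carrier G"
    using U openin_subset[OF U(1)] by (auto simp: topspace_eq_carrier)
  have "x \<in> U #> (inv u \<otimes> x)" if "x \<in> carrier G" for x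
  proof -
    have "u \<otimes> (inv u \<otimes> x) = x"
      using u that by (simp flip: m_assoc)
    then show ?thesis
      using u by (auto simp: r_coset_def intro!: bexI[of _ u])
  qed
  then have "K \<subseteq> \<Union> ((\<lambda>g. U #> g) ` carrier G)"
    using compactin_subset_topspace[OF K] u by (fastforce simp: topspace_eq_carrier)
  then obtain \<F> where "finite \<F>" "\<F> \<subseteq> (\<lambda>g. U #> g) ` carrier G" "K \<subseteq> \<Union>\<F>"
    using compactinD[OF K, of "(\<lambda>g. U #> g) ` carrier G"] U by (auto intro: openin_r_coset)
  then obtain F0 where "finite F0" "F0 \<subseteq> carrier G" "K \<subseteq> (\<Union>g\<in>F0. U #> g)"
    by (metis finite_subset_image)
  then have "card ` {F. finite F \<and> F \<subseteq> carrier G \<and> K \<subseteq> (\<Union>g\<in>F. U #> g)} \<noteq> {}"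
    by auto
  from Inf_nat_def1[OF this] that show thesis
    unfolding covering_number_def by (auto simp: image_iff)
qed

lemma covering_number_mono:
  assumes "K \<subseteq> L" "compactin T L" "openin T U" "U \<noteq> {}"
  shows "covering_number K U \<le> covering_number L U"
proof -
  obtain F where F: "finite F" "F \<subseteq> carrier G" "L \<subseteq> (\<Union>g\<in>F. U #> g)" "card F = covering_number L U"
    using covering_number_attained assms by metis
  then show ?thesis using covering_number_le[of F K U] assms by auto
qed

lemma covering_number_Un:
  assumes "compactin T K" "compactin T L" "openin T U" "U \<noteq> {}"
  shows "covering_number (K \<union> L) U \<le> covering_number K U + covering_number L U"
proof -
  obtain A where A: "finite A" "A \<subseteq> carrier G" "K \<subseteq> (\<Union>g\<in>A. U #> g)" "card A = covering_number K U"
    using covering_number_attained assms by metis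
  obtain B where B: "finite B" "B \<subseteq> carrier G" "L \<subseteq> (\<Union>g\<in>B. U #> g)" "card B = covering_number L U"
    using covering_number_attained assms by metis
  have "covering_number (K \<union> L) U \<le> card (A \<union> B)"
    using A B by (intro covering_number_le) auto
  also have "\<dots> \<le> card A + card B" by (rule card_Un_le)
  finally show ?thesis using A B by simp
qed

text \<open>Since no translate of \<open>U\<close> meets both sets, an optimal cover of
  \<open>K \<union> L\<close> contains disjoint subfamilies that cover \<open>K\<close> and
  \<open>L\<close>.\<close>

lemma covering_number_separated:
  assumes K: "compactin T K" and L: "compactin T L" and U: "openin T U" "U \<noteq> {}"
    and sep: "\<And>g. g \<in> carrier G \<Longrightarrow> (U #> g) \<inter> K = {} \<or> (U #> g) \<inter> L = {}"
  shows "covering_number K U + covering_number L U \<le> covering_number (K \<union> L) U"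
proof -
  obtain F where F: "finite F" "F \<subseteq> carrier G" "K \<union> L \<subseteq> (\<Union>g\<in>F. U #> g)"
      "card F = covering_number (K \<union> L) U"
    by (rule covering_number_attained[OF compactin_Un[OF K L] U])
  define A B where "A = {g\<in>F. (U #> g) \<inter> K \<noteq> {}}" and "B = {g\<in>F. (U #> g) \<inter> L \<noteq> {}}"
  have "K \<subseteq> (\<Union>g\<in>A. U #> g)"
  proof
    fix x assume "x \<in> K"
    moreover from this obtain g where "g \<in> F" "x \<in> U #> g" using F(3) by blast
    ultimately show "x \<in> (\<Union>g\<in>A. U #> g)" by (auto simp: A_def)
  qed
  then have leA: "covering_number K U \<le> card A"
    using F(1,2) by (intro covering_number_le) (simp_all add: A_def subset_iff)
  have "L \<subseteq> (\<Union>g\<in>B. U #> g)"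
  proof
    fix x assume "x \<in> L"
    moreover from this obtain g where "g \<in> F" "x \<in> U #> g" using F(3) by blast
    ultimately show "x \<in> (\<Union>g\<in>B. U #> g)" by (auto simp: B_def)
  qed
  then have leB: "covering_number L U \<le> card B"
    using F(1,2) by (intro covering_number_le) (simp_all add: B_def subset_iff)
  have "A \<inter> B = {}"
    using sep F(2) by (auto simp: A_def B_def)
  then have "card A + card B = card (A \<union> B)"
    using F(1) by (intro card_Un_disjoint[symmetric]) (auto simp: A_def B_def)
  moreover have "card (A \<union> B) \<le> card F"
    using F(1) by (intro card_mono) (auto simp: A_def B_def)
  ultimately show ?thesis using F leA leB by linarith
qed

lemma covering_number_r_coset:
  assumes K: "compactin T K" and U: "openin T U" "U \<noteq> {}" and g: "g \<in> carrier G"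
  shows "covering_number (K #> g) U = covering_number K U"
proof -
  have *: "covering_number (L #> x) U \<le> covering_number L U" 
    if L: "compactin T L" and x: "x \<in> carrier G" for L x
  proof -
    obtain F where F: "finite F" "F \<subseteq> carrier G" "L \<subseteq> (\<Union>g\<in>F. U #> g)" "card F = covering_number L U"
      using covering_number_attained[OF L U] by metis
    have "L #> x \<subseteq> (\<Union>g\<in>F. (U #> g) #> x)"
      using F(3) by (fastforce simp: r_coset_def)
    also have "\<dots> = (\<Union>g\<in>(\<lambda>y. y \<otimes> x) ` F. U #> g)"
      using F(2) x openin_subset[OF U(1)] by (auto simp: coset_mult_assoc topspace_eq_carrier subset_eq)
    finally have "covering_number (L #> x) U \<le> card ((\<lambda>y. y \<otimes> x) ` F)"
      using F x by (intro covering_number_le) auto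
    also have "\<dots> \<le> card F" by (intro card_image_le F)
    finally show ?thesis using F by simp
  qed
  have "(K #> g) #> inv g = K"
    using g compactin_subset_topspace[OF K] by (intro r_coset_inv_cancel) (auto simp: topspace_eq_carrier)
  then show ?thesis
    using *[OF K g] *[OF compactin_r_coset[OF K g], of "inv g"] g by simp
qed

text \<open>Substitute a cover of \<open>L\<close> into a cover of \<open>K\<close> by translates of
  \<open>V\<close>. Dividing by (L : U) bounds the covering ratio by (K : V), independently of
  \<open>U\<close>, which keeps the limit finite.\<close>

lemma covering_number_trans:
  assumes K: "compactin T K" and V: "openin T V" "V \<noteq> {}" "V \<subseteq> L" and L: "compactin T L"
    and U: "openin T U" "U \<noteq> {}"
  shows "covering_number K U \<le> covering_number K V * covering_number L U"
proof -
  obtain A where A: "finite A" "A \<subseteq> carrier G" "K \<subseteq> (\<Union>g\<in>A. V #> g)" "card A = covering_number K V"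
    using covering_number_attained[OF K V(1,2)] by metis
  obtain B where B: "finite B" "B \<subseteq> carrier G" "L \<subseteq> (\<Union>g\<in>B. U #> g)" "card B = covering_number L U"
    using covering_number_attained[OF L U] by metis
  let ?F = "(\<lambda>(a, b). b \<otimes> a) ` (A \<times> B)"
  have "K \<subseteq> (\<Union>g\<in>?F. U #> g)"
  proof
    fix x assume "x \<in> K"
    then obtain a where a: "a \<in> A" "x \<in> V #> a" using A by auto
    then obtain v where v: "v \<in> V" "x = v \<otimes> a" by (auto simp: r_coset_def)
    moreover have "v \<in> (\<Union>g\<in>B. U #> g)" using v B V by (meson subsetD)
    ultimately obtain b where b: "b \<in> B" "v \<in> U #> b" by (meson UN_E)
    then have "x \<in> (U #> b) #> a" using v by (auto simp: r_coset_def)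
    also have "(U #> b) #> a = U #> (b \<otimes> a)"
      using a b A B openin_subset[OF U(1)] by (auto simp: coset_mult_assoc topspace_eq_carrier subset_eq)
    finally show "x \<in> (\<Union>g\<in>?F. U #> g)" using a b by auto
  qed
  then have "covering_number K U \<le> card ?F"
    using A B by (intro covering_number_le) auto
  also have "\<dots> \<le> card (A \<times> B)" using A B by (intro card_image_le) auto
  finally show ?thesis using A B by (simp add: card_cartesian_product)
qed

lemma covering_number_pos:
  assumes "compactin T K" "K \<noteq> {}" "openin T U" "U \<noteq> {}"
  shows "covering_number K U > 0"
proof -
  obtain F where F: "finite F" "F \<subseteq> carrier G" "K \<subseteq> (\<Union>g\<in>F. U #> g)" "card F = covering_number K U"
    using covering_number_attained assms by metis
  then show ?thesis using assms(2) by (metis UN_empty card_gt_0_iff subset_empty)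
qed

lemma continuous_map_inv: "continuous_map T T (\<lambda>x. inv x)"
proof -
  have "continuous_map T (prod_topology T T) (\<lambda>x. (x, \<one>))"
    by (auto intro!: continuous_intros simp: continuous_map_pairwise o_def topspace_eq_carrier)
  from continuous_map_compose[OF this continuous_inv_mult]
  have "continuous_map T T (\<lambda>x. inv x \<otimes> \<one>)" by (simp add: o_def)
  then show ?thesis
    by (rule continuous_map_eq) (simp add: topspace_eq_carrier)
qed

lemma continuous_map_mult_inv: "continuous_map (prod_topology T T) T (\<lambda>(x, y). x \<otimes> inv y)"
proof -
  have "continuous_map (prod_topology T T) (prod_topology T T) (\<lambda>p. (inv (fst p), inv (snd p)))"
    unfolding continuous_map_pairwise o_def fst_conv snd_conv
    by (intro conjI continuous_map_compose[OF continuous_map_fst continuous_map_inv, unfolded o_def]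
        continuous_map_compose[OF continuous_map_snd continuous_map_inv, unfolded o_def])
  from continuous_map_compose[OF this continuous_inv_mult]
  have "continuous_map (prod_topology T T) T (\<lambda>p. inv (inv (fst p)) \<otimes> inv (snd p))"
    by (simp add: o_def)
  then show ?thesis
    by (rule continuous_map_eq) (auto simp: topspace_eq_carrier)
qed

text \<open>If \<open>v \<otimes> g \<in> K\<close> and \<open>w \<otimes> g \<in> L\<close>, then
  \<open>v \<otimes> inv w\<close> lies in the set of all \<open>x \<otimes> inv y\<close> with
  \<open>x \<in> K\<close>, \<open>y \<in> L\<close>. That set is compact, hence closed, and misses
  \<open>\<one>\<close>; continuity at \<open>(\<one>, \<one>)\<close> supplies
  \<open>U\<close>.\<close>

lemma disjoint_compactin_separated:
  assumes K: "compactin T K" and L: "compactin T L" and "disjnt K L"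
  obtains U where "openin T U" "\<one> \<in> U"
    "\<And>V g. V \<subseteq> U \<Longrightarrow> g \<in> carrier G \<Longrightarrow> (V #> g) \<inter> K = {} \<or> (V #> g) \<inter> L = {}"
proof -
  let ?f = "\<lambda>(x, y). x \<otimes> inv y"
  have Ks: "K \<subseteq> carrier G" "L \<subseteq> carrier G"
    using K L compactin_subset_topspace topspace_eq_carrier by auto
  have "compactin T (?f ` (K \<times> L))"
    using K L by (intro image_compactin[OF _ continuous_map_mult_inv]) (simp add: compactin_Times)
  then have "closedin T (?f ` (K \<times> L))"
    by (intro compactin_imp_closedin Hausdorff)
  then have W: "openin T (topspace T - ?f ` (K \<times> L))" (is "openin T ?W") by auto
  have one: "\<one> \<in> ?W"
  proof -
    have "x \<otimes> inv y \<noteq> \<one>" if "x \<in> K" "y \<in> L" for x y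
    proof
      assume "x \<otimes> inv y = \<one>"
      then have "x = y" using that Ks by (metis inv_equality inv_inv inv_closed subsetD)
      then show False using that \<open>disjnt K L\<close> by (auto simp: disjnt_def)
    qed
    then show ?thesis by (force simp: topspace_eq_carrier)
  qed
  have "openin (prod_topology T T) {p \<in> topspace (prod_topology T T). ?f p \<in> ?W}"
    using W continuous_map_mult_inv unfolding continuous_map_def by blast
  moreover have "(\<one>, \<one>) \<in> {p \<in> topspace (prod_topology T T). ?f p \<in> ?W}"
    using one by (simp add: topspace_eq_carrier)
  ultimately obtain A B where AB: "openin T A" "openin T B" "\<one> \<in> A" "\<one> \<in> B"
      "A \<times> B \<subseteq> {p \<in> topspace (prod_topology T T). ?f p \<in> ?W}"
    unfolding openin_prod_topology_alt by meson
  show thesis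
  proof
    show "openin T (A \<inter> B)" "\<one> \<in> A \<inter> B" using AB by auto
    fix V g assume V: "V \<subseteq> A \<inter> B" and g: "g \<in> carrier G"
    show "(V #> g) \<inter> K = {} \<or> (V #> g) \<inter> L = {}"
    proof (rule ccontr)
      assume "\<not> ?thesis"
      then obtain v w where vw: "v \<in> V" "w \<in> V" "v \<otimes> g \<in> K" "w \<otimes> g \<in> L"
        by (auto simp: r_coset_def)
      then have c: "v \<in> carrier G" "w \<in> carrier G"
        using V AB openin_subset topspace_eq_carrier by blast+
      have "(v \<otimes> g) \<otimes> inv (w \<otimes> g) = v \<otimes> inv w"
        using c g by (simp add: inv_mult_group m_assoc) (simp flip: m_assoc)
      moreover have "(v \<otimes> g) \<otimes> inv (w \<otimes> g) \<in> ?f ` (K \<times> L)"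
        using vw by force
      moreover have "(v, w) \<in> A \<times> B"
        using vw V by auto
      then have "?f (v, w) \<in> ?W"
        using AB(5) by (metis (no_types, lifting) mem_Collect_eq subsetD)
      ultimately show False by simp
    qed
  qed
qed

theorem ex_right_invariant_radon_measure:
  "\<exists>M. radon_measure T M \<and> emeasure M (space M) \<noteq> 0 \<and>
     (\<forall>g\<in>carrier G. \<forall>E\<in>sets M. emeasure M (E #> g) = emeasure M E)"
proof -
  obtain V0 K0 where V0: "openin T V0" "\<one> \<in> V0" "V0 \<subseteq> K0" and K0: "compactin T K0"
    using locally_compact unfolding locally_compact_space_def
    by (metis one_closed topspace_eq_carrier)
  define N where "N = {U. openin T U \<and> \<one> \<in> U}"
  have N: "openin T U" "U \<noteq> {}" if "U \<in> N" for U
    using that by (auto simp: N_def)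
  \<comment> \<open>The filter of shrinking neighbourhoods of \<open>\<one>\<close>: a property
    holds eventually when it holds for all sufficiently small \<open>U\<close>.\<close>
  define F where "F = (INF V\<in>N. principal {U\<in>N. U \<subseteq> V})"
  have ev: "eventually P F \<longleftrightarrow> (\<exists>V\<in>N. \<forall>U\<in>N. U \<subseteq> V \<longrightarrow> P U)" for P
    unfolding F_def
  proof (subst eventually_INF_base)
    show "N \<noteq> {}" using V0 by (auto simp: N_def)
    fix A B assume "A \<in> N" "B \<in> N"
    then show "\<exists>C\<in>N. principal {U\<in>N. U \<subseteq> C} \<le> inf (principal {U\<in>N. U \<subseteq> A}) (principal {U\<in>N. U \<subseteq> B})"
      by (intro bexI[of _ "A \<inter> B"]) (auto simp: N_def openin_Int)
  qed (auto simp: eventually_principal)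
  have "F \<noteq> bot"
  proof
    assume "F = bot"
    then have "eventually (\<lambda>_. False) F" by simp
    then show False unfolding ev by auto
  qed
  \<comment> \<open>Dividing by the index of \<open>K0\<close> fixes the scale:
    \<open>\<psi> U K0\<close> is 1 for every \<open>U\<close>, so the cluster point cannot
    vanish.\<close>
  define \<psi> where "\<psi> U K = ennreal (real (covering_number K U) / real (covering_number K0 U))" for U K
  obtain \<kappa> where \<kappa>: "\<And>C. closed C \<Longrightarrow> (\<forall>\<^sub>F U in F. \<psi> U \<in> C) \<Longrightarrow> \<kappa> \<in> C"
    using ennreal_fun_cluster_point[OF \<open>F \<noteq> bot\<close>, where \<psi> = \<psi>] by metis
  have evN: "eventually P F" if "\<And>U. U \<in> N \<Longrightarrow> P U" for P
    unfolding ev using that V0 by (auto simp: N_def)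
  have pos0: "covering_number K0 U > 0" if "U \<in> N" for U
    using that V0 N by (intro covering_number_pos K0) auto
  interpret right_invariant_content G T \<kappa>
  proof unfold_locales
    show "Hausdorff_space T" "locally_compact_space T" by (rule Hausdorff locally_compact)+
  next
    fix K assume K: "compactin T K"
    have "\<kappa> \<in> {f. f K \<le> ennreal (real (covering_number K V0))}"
    proof (rule \<kappa>)
      show "\<forall>\<^sub>F U in F. \<psi> U \<in> {f. f K \<le> ennreal (real (covering_number K V0))}"
      proof (rule evN)
        fix U assume U: "U \<in> N"
        have "covering_number K U \<le> covering_number K V0 * covering_number K0 U"
          using U V0 N by (intro covering_number_trans K K0) auto
        then have "real (covering_number K U) \<le> real (covering_number K V0) * real (covering_number K0 U)"
          by (metis of_nat_le_iff of_nat_mult)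
        then show "\<psi> U \<in> {f. f K \<le> ennreal (real (covering_number K V0))}"
          using pos0[OF U] by (simp add: \<psi>_def divide_simps)
      qed
    qed (intro closed_Collect_le continuous_intros continuous_on_product_coordinates)
    then show "\<kappa> K < \<infinity>"
      by (auto intro: le_less_trans)
  next
    fix K L assume KL: "compactin T K" "compactin T L" "K \<subseteq> L"
    have "\<kappa> \<in> {f. f K \<le> f L}"
    proof (rule \<kappa>)
      show "\<forall>\<^sub>F U in F. \<psi> U \<in> {f. f K \<le> f L}"
        using KL by (intro evN)
          (auto simp: \<psi>_def intro!: ennreal_leI divide_right_mono covering_number_mono dest: N)
    qed (intro closed_Collect_le continuous_intros continuous_on_product_coordinates)
    then show "\<kappa> K \<le> \<kappa> L" by simp
  next
    fix K L assume KL: "compactin T K" "compactin T L"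
    have "\<kappa> \<in> {f. f (K \<union> L) \<le> f K + f L}"
    proof (rule \<kappa>)
      show "\<forall>\<^sub>F U in F. \<psi> U \<in> {f. f (K \<union> L) \<le> f K + f L}"
      proof (rule evN)
        fix U assume U: "U \<in> N"
        have "real (covering_number (K \<union> L) U) \<le> real (covering_number K U) + real (covering_number L U)"
          using covering_number_Un[OF KL N[OF U]] by linarith
        then show "\<psi> U \<in> {f. f (K \<union> L) \<le> f K + f L}"
          by (auto simp: \<psi>_def simp flip: ennreal_plus add_divide_distrib
              intro!: ennreal_leI divide_right_mono)
      qed
    qed (intro closed_Collect_le continuous_intros continuous_on_product_coordinates)
    then show "\<kappa> (K \<union> L) \<le> \<kappa> K + \<kappa> L" by simp
  next
    fix K L assume KL: "compactin T K" "compactin T L" "disjnt K L"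
    have "\<kappa> \<in> {f. f K + f L \<le> f (K \<union> L)}"
    proof (rule \<kappa>)
      \<comment> \<open>Superadditivity is the one property that needs \<open>U\<close> small, and
        the reason for passing to a limit; the others hold for each
        \<open>U \<in> N\<close>.\<close>
      obtain W where W: "openin T W" "\<one> \<in> W"
        "\<And>V g. V \<subseteq> W \<Longrightarrow> g \<in> carrier G \<Longrightarrow> (V #> g) \<inter> K = {} \<or> (V #> g) \<inter> L = {}"
        using disjoint_compactin_separated[OF KL] by metis
      have "\<psi> U \<in> {f. f K + f L \<le> f (K \<union> L)}" if U: "U \<in> N" "U \<subseteq> W" for U
      proof -
        have "real (covering_number K U) + real (covering_number L U) \<le> real (covering_number (K \<union> L) U)"
          using covering_number_separated[OF KL(1,2) N[OF U(1)] W(3)[OF U(2)]] by linarith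
        then show ?thesis
          by (auto simp: \<psi>_def simp flip: ennreal_plus add_divide_distrib
              intro!: ennreal_leI divide_right_mono)
      qed
      then show "\<forall>\<^sub>F U in F. \<psi> U \<in> {f. f K + f L \<le> f (K \<union> L)}"
        unfolding ev using W by (auto simp: N_def)
    qed (intro closed_Collect_le continuous_intros continuous_on_product_coordinates)
    then show "\<kappa> K + \<kappa> L \<le> \<kappa> (K \<union> L)" by simp
  next
    fix K g assume Kg: "compactin T K" "g \<in> carrier G"
    have "\<kappa> \<in> {f. f (K #> g) = f K}"
    proof (rule \<kappa>)
      show "\<forall>\<^sub>F U in F. \<psi> U \<in> {f. f (K #> g) = f K}"
        using Kg by (intro evN) (auto simp: \<psi>_def N covering_number_r_coset)
    qed (intro closed_Collect_eq continuous_intros continuous_on_product_coordinates)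
    then show "\<kappa> (K #> g) = \<kappa> K" by simp
  qed
  have "\<kappa> \<in> {f. f K0 = 1}"
  proof (rule \<kappa>)
    show "\<forall>\<^sub>F U in F. \<psi> U \<in> {f. f K0 = 1}"
      by (intro evN) (use pos0 in \<open>auto simp: \<psi>_def\<close>)
  qed (intro closed_Collect_eq continuous_intros continuous_on_product_coordinates)
  then have "1 \<le> emeasure content_measure K0"
    using content_le_emeasure[OF K0] by simp
  also have "\<dots> \<le> emeasure content_measure (space content_measure)"
    by (rule emeasure_space)
  finally have "emeasure content_measure (space content_measure) \<noteq> 0" by auto
  then show ?thesis
    using radon_measure_content_measure emeasure_content_measure_r_coset by blast
qed

end

subsection \<open>Quotients of right topological groups\<close>

lemma Hausdorff_space_open_map_image:
  assumes f: "open_map X Y f" "f ` topspace X = topspace Y"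
    and closed: "closedin (prod_topology X X) {(x, y). x \<in> topspace X \<and> y \<in> topspace X \<and> f x = f y}"
  shows "Hausdorff_space Y"
  unfolding Hausdorff_space_def
proof (intro allI impI)
  fix a b assume ab: "a \<in> topspace Y \<and> b \<in> topspace Y \<and> a \<noteq> b"
  then obtain x y where xy: "x \<in> topspace X" "y \<in> topspace X" "a = f x" "b = f y"
    using f(2) by blast
  let ?R = "{(x, y). x \<in> topspace X \<and> y \<in> topspace X \<and> f x = f y}"
  have "openin (prod_topology X X) (topspace X \<times> topspace X - ?R)"
    using openin_diff[OF openin_topspace closed] by simp
  moreover have "(x, y) \<in> topspace X \<times> topspace X - ?R"
    using xy ab by auto
  ultimately obtain U V where UV: "openin X U" "openin X V" "x \<in> U" "y \<in> V"
      "U \<times> V \<subseteq> topspace X \<times> topspace X - ?R"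
    unfolding openin_prod_topology_alt by meson
  show "\<exists>U V. openin Y U \<and> openin Y V \<and> a \<in> U \<and> b \<in> V \<and> disjnt U V"
  proof (intro exI conjI)
    show "openin Y (f ` U)" "openin Y (f ` V)"
      using f(1) UV by (auto simp: open_map_def)
    show "disjnt (f ` U) (f ` V)"
      using UV(5) by (fastforce simp: disjnt_iff)
  qed (use UV xy in auto)
qed

lemma open_map_prod:
  assumes f: "open_map X X' f" and g: "open_map Y Y' g"
  shows "open_map (prod_topology X Y) (prod_topology X' Y') (\<lambda>(x, y). (f x, g y))"
  unfolding open_map_def
proof (intro allI impI)
  fix W assume W: "openin (prod_topology X Y) W"
  show "openin (prod_topology X' Y') ((\<lambda>(x, y). (f x, g y)) ` W)"
    unfolding openin_prod_topology_alt
  proof (intro allI impI)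
    fix a b assume "(a, b) \<in> (\<lambda>(x, y). (f x, g y)) ` W"
    then obtain x y where xy: "(x, y) \<in> W" "a = f x" "b = g y" by auto
    then obtain U V where UV: "openin X U" "openin Y V" "x \<in> U" "y \<in> V" "U \<times> V \<subseteq> W"
      using W unfolding openin_prod_topology_alt by meson
    then show "\<exists>U V. openin X' U \<and> openin Y' V \<and> a \<in> U \<and> b \<in> V \<and>
        U \<times> V \<subseteq> (\<lambda>(x, y). (f x, g y)) ` W"
      using f g xy unfolding open_map_def
      by (intro exI[of _ "f ` U"] exI[of _ "g ` V"]) force
  qed
qed

lemma interior_nonempty_of_countable_closed_cover:
  fixes A :: "nat \<Rightarrow> 'a set"
  assumes X: "locally_compact_space X" "Hausdorff_space X" and "topspace X \<noteq> {}"
    and A: "\<And>n. closedin X (A n)" "topspace X = (\<Union>n. A n)"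
  obtains n where "X interior_of (A n) \<noteq> {}"
proof -
  have "regular_space X"
    using X by (simp add: locally_compact_Hausdorff_imp_regular_space)
  have "X interior_of \<Union>(range A) = {}" if "\<And>n. X interior_of (A n) = {}"
    using \<open>regular_space X\<close> X(1) that A(1) by (intro Baire_category_alt) auto
  then show thesis
    using that \<open>topspace X \<noteq> {}\<close> A(2) by (metis interior_of_topspace)
qed

text \<open>By Baire some \<open>T\<close>-compact set has an \<open>S\<close>-interior point. On a
  \<open>T\<close>-compact set the coarser Hausdorff topology agrees with \<open>T\<close>:
  relatively closed subsets are \<open>T\<close>-compact, hence \<open>S\<close>-compact, hence
  \<open>S\<close>-closed. Right translations are homeomorphisms for both topologies and carry the
  agreement from that point to all others.\<close>

lemma (in right_topological_group) topology_eq_coarser_locally_compact: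
  assumes S: "right_topological_group G S"
    and coarser: "\<And>U. openin S U \<Longrightarrow> openin T U"
    and compacts: "sigma_compact_space T"
    and lc: "locally_compact_space S" "Hausdorff_space S"
  shows "S = T"
proof -
  interpret S: right_topological_group G S by (rule S)
  have sub: "compactin S K" if "compactin T K" for K
    using compactin_contractive[OF that] coarser S.topspace_eq_carrier topspace_eq_carrier by auto
  obtain K :: "nat \<Rightarrow> 'a set" where K: "\<And>n. compactin T (K n)" "topspace T = (\<Union>n. K n)"
    using compacts unfolding sigma_compact_space_def by blast
  have "\<And>n. closedin S (K n)" "topspace S = (\<Union>n. K n)"
    using K sub lc by (auto simp: S.topspace_eq_carrier topspace_eq_carrier compactin_imp_closedin)
  moreover have "topspace S \<noteq> {}" using S.topspace_eq_carrier by auto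
  ultimately obtain n where "S interior_of (K n) \<noteq> {}"
    using interior_nonempty_of_countable_closed_cover[OF lc] by metis
  then obtain w where w: "w \<in> S interior_of (K n)" by auto
  define W where "W = S interior_of (K n)"
  have W: "openin S W" "W \<subseteq> K n" "w \<in> W" "w \<in> carrier G"
    using w interior_of_subset_topspace[of S "K n"] S.topspace_eq_carrier
    by (auto simp: W_def interior_of_subset)
  have local: "openin S V" if V: "openin T V" "V \<subseteq> W" for V
  proof -
    have "compactin T ((topspace T - V) \<inter> K n)"
      using V K(1) by (intro closed_Int_compactin) auto
    then have "closedin S ((topspace T - V) \<inter> K n)"
      using sub lc by (intro compactin_imp_closedin)
    then have "openin S (W - ((topspace T - V) \<inter> K n))"
      using W by auto
    moreover have "W - ((topspace T - V) \<inter> K n) = V"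
      using V W openin_subset[OF W(1)] S.topspace_eq_carrier topspace_eq_carrier by auto
    ultimately show ?thesis by simp
  qed
  have "openin S U" if U: "openin T U" for U
  proof (subst openin_subopen, intro ballI)
    fix x assume x: "x \<in> U"
    have Uc: "U \<subseteq> carrier G" using openin_subset[OF U] topspace_eq_carrier by simp
    then have xc: "x \<in> carrier G" using x by auto
    define g where "g = inv w \<otimes> x"
    have g: "g \<in> carrier G" using W xc by (simp add: g_def)
    have wg: "w \<otimes> g = x" using W xc by (simp add: g_def flip: m_assoc)
    have "x \<otimes> inv g = w" using W xc g by (simp add: m_assoc flip: wg)
    then have "w \<in> U #> inv g" using x by (auto simp: r_coset_def)
    have "openin S ((U #> inv g) \<inter> W)"
      using U g W coarser by (intro local openin_Int openin_r_coset) auto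
    then have "openin S (((U #> inv g) \<inter> W) #> g)"
      using g by (rule S.openin_r_coset)
    moreover have "x \<in> ((U #> inv g) \<inter> W) #> g"
      using wg W \<open>w \<in> U #> inv g\<close> by (auto simp: r_coset_def)
    moreover have "((U #> inv g) \<inter> W) #> g \<subseteq> (U #> inv g) #> g"
      by (auto simp: r_coset_def)
    ultimately show "\<exists>V. openin S V \<and> x \<in> V \<and> V \<subseteq> U"
      using g Uc by (auto simp: r_coset_inv_cancel)
  qed
  then show ?thesis
    using coarser by (auto simp: topology_eq)
qed

section \<open>The \<sigma>-topology\<close>

context right_topological_group
begin

lemma quotient_map_sigma_topology:
  "quotient_map (prod_topology T T) (sigma_topology G T) (\<lambda>(x, y). inv x \<otimes> y)"
  unfolding sigma_topology_def by (rule quotient_map_quotient_topology)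

text \<open>Right translation by \<open>g\<close> lifts along the quotient map to
  \<open>(x, y) \<mapsto> (x, y \<otimes> g)\<close>. This lets facts about \<tau> be reused for
  \<sigma>, and so for \<sigma>\<sigma>.\<close>

lemma right_topological_group_sigma_topology:
  "right_topological_group G (sigma_topology G T)"
proof
  show "topspace (sigma_topology G T) = carrier G"
    by (rule topspace_sigma_topology[OF topspace_eq_carrier])
  fix g assume g: "g \<in> carrier G"
  let ?f = "\<lambda>(x, y). inv x \<otimes> y"
  have "continuous_map (prod_topology T T) (prod_topology T T) (\<lambda>(x, y). (x, y \<otimes> g))"
    using continuous_right_mult[OF g]
    by (simp add: continuous_map_prod_top)
  from continuous_map_compose[OF this quotient_imp_continuous_map[OF quotient_map_sigma_topology]]
  have "continuous_map (prod_topology T T) (sigma_topology G T) ((\<lambda>x. x \<otimes> g) \<circ> ?f)"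
    by (rule continuous_map_eq) (use g in \<open>auto simp: topspace_eq_carrier m_assoc\<close>)
  then show "continuous_map (sigma_topology G T) (sigma_topology G T) (\<lambda>x. x \<otimes> g)"
    by (rule continuous_compose_quotient_map[OF quotient_map_sigma_topology])
qed

text \<open>Restricting the quotient map to \<open>x = \<one>\<close> gives the identity.\<close>

lemma openin_sigma_topology_imp_openin:
  assumes "openin (sigma_topology G T) U" shows "openin T U"
proof -
  have "continuous_map T (prod_topology T T) (\<lambda>y. (\<one>, y))"
    by (auto simp: continuous_map_pairwise o_def topspace_eq_carrier)
  from continuous_map_compose[OF this quotient_imp_continuous_map[OF quotient_map_sigma_topology]]
  have "continuous_map T (sigma_topology G T) (\<lambda>y. y)"
    by (rule continuous_map_eq) (auto simp: topspace_eq_carrier)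
  then have "openin T {x \<in> topspace T. x \<in> U}"
    using assms unfolding continuous_map_def by auto
  moreover have "{x \<in> topspace T. x \<in> U} = U"
    using openin_subset[OF assms] topspace_sigma_topology[OF topspace_eq_carrier] topspace_eq_carrier
    by auto
  ultimately show ?thesis by simp
qed

text \<open>If \<open>x\<inverse> y = u\<inverse> v\<close> with \<open>(u, v)\<close> in the open set, then \<open>s = u x\<inverse>\<close> maps \<open>(x, y)\<close> into it by a left
  translation.  Right continuity allows replacing \<open>s\<close> by a nearby element of the dense topological
  center, and left translation by that element is continuous.\<close>

lemma open_map_sigma_topology:
  assumes "admissible G T"
  shows "open_map (prod_topology T T) (sigma_topology G T) (\<lambda>(x, y). inv x \<otimes> y)"
  unfolding open_map_def
proof (intro allI impI)
  let ?f = "\<lambda>(x, y). inv x \<otimes> y"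
  fix W assume W: "openin (prod_topology T T) W"
  have Wc: "W \<subseteq> carrier G \<times> carrier G"
    using openin_subset[OF W] by (simp add: topspace_eq_carrier)
  have "openin (prod_topology T T) {p \<in> topspace (prod_topology T T). ?f p \<in> ?f ` W}"
    unfolding openin_prod_topology_alt
  proof (intro allI impI)
    fix x y assume "(x, y) \<in> {p \<in> topspace (prod_topology T T). ?f p \<in> ?f ` W}"
    then obtain u v where xy: "x \<in> carrier G" "y \<in> carrier G" and uv: "(u, v) \<in> W"
      and eq: "inv x \<otimes> y = inv u \<otimes> v"
      by (auto simp: topspace_eq_carrier)
    have uvc: "u \<in> carrier G" "v \<in> carrier G" using uv Wc by auto
    obtain U V where UV: "openin T U" "openin T V" "u \<in> U" "v \<in> V" "U \<times> V \<subseteq> W"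
      using W uv unfolding openin_prod_topology_alt by meson
    define s where "s = u \<otimes> inv x"
    have s: "s \<in> carrier G" "s \<otimes> x = u" "s \<otimes> y = v"
      using xy uvc eq by (simp_all add: s_def m_assoc) (simp flip: m_assoc)
    define N where "N = {t \<in> topspace T. t \<otimes> x \<in> U} \<inter> {t \<in> topspace T. t \<otimes> y \<in> V}"
    have "openin T N"
      unfolding N_def using UV continuous_right_mult xy by (intro openin_Int) (auto simp: continuous_map_def)
    moreover have "s \<in> T closure_of topological_center G T"
      using assms s by (simp add: admissible_def topspace_eq_carrier)
    moreover have "s \<in> N"
      using s UV by (simp add: N_def topspace_eq_carrier)
    ultimately obtain t where t: "t \<in> topological_center G T" "t \<in> N"
      by (metis in_closure_of)
    then have tUV: "t \<otimes> x \<in> U" "t \<otimes> y \<in> V" by (auto simp: N_def)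
    from t(1) have tc: "t \<in> carrier G" "continuous_map T T (\<lambda>g. t \<otimes> g)"
      by (auto simp: topological_center_def)
    show "\<exists>U V. openin T U \<and> openin T V \<and> x \<in> U \<and> y \<in> V \<and>
        U \<times> V \<subseteq> {p \<in> topspace (prod_topology T T). ?f p \<in> ?f ` W}"
    proof (intro exI conjI)
      let ?A = "{a \<in> topspace T. t \<otimes> a \<in> U}" and ?B = "{b \<in> topspace T. t \<otimes> b \<in> V}"
      show "openin T ?A" "openin T ?B"
        using tc(2) UV by (auto simp: continuous_map_def)
      show "x \<in> ?A" "y \<in> ?B" using xy tUV by (auto simp: topspace_eq_carrier)
      show "?A \<times> ?B \<subseteq> {p \<in> topspace (prod_topology T T). ?f p \<in> ?f ` W}"
      proof safe
        fix a b assume ab: "a \<in> topspace T" "t \<otimes> a \<in> U" "b \<in> topspace T" "t \<otimes> b \<in> V"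
        then show "(a, b) \<in> topspace (prod_topology T T)" by simp
        have "inv (t \<otimes> a) \<otimes> (t \<otimes> b) = inv a \<otimes> (inv t \<otimes> (t \<otimes> b))"
          using ab tc by (simp add: topspace_eq_carrier inv_mult_group m_assoc)
        also have "inv t \<otimes> (t \<otimes> b) = b"
          using ab tc by (simp add: topspace_eq_carrier flip: m_assoc)
        finally have "inv a \<otimes> b = ?f (t \<otimes> a, t \<otimes> b)" by simp
        moreover have "(t \<otimes> a, t \<otimes> b) \<in> W" using ab UV by auto
        ultimately show "inv a \<otimes> b \<in> ?f ` W" by (metis imageI)
      qed
    qed
  qed
  moreover have "?f ` W \<subseteq> ?f ` topspace (prod_topology T T)"
    using openin_subset[OF W] by (rule image_mono)
  ultimately show "openin (sigma_topology G T) (?f ` W)"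
    unfolding sigma_topology_def openin_quotient_topology by blast
qed

end

section \<open>Quotient by a normal subgroup\<close>

locale right_topological_group_normal = right_topological_group G T + normal H G
  for G (structure) and T :: "'a topology" and H
begin

definition quotient_space :: "'a set topology" where
  "quotient_space = quotient_topology T (\<lambda>x. H #> x)"

lemma topspace_quotient_space: "topspace quotient_space = carrier (G Mod H)"
  by (simp add: quotient_space_def topspace_eq_carrier carrier_FactGroup)

lemma quotient_map_quotient_space: "quotient_map T quotient_space (\<lambda>x. H #> x)"
  unfolding quotient_space_def by (rule quotient_map_quotient_topology)

text \<open>Normality replaces the usual criterion for right cosets by the one for left cosets,
  which matches the map that defines the \<sigma>-topology.\<close>

lemma r_coset_eq_iff:
  assumes "x \<in> carrier G" "y \<in> carrier G"
  shows "H #> x = H #> y \<longleftrightarrow> inv x \<otimes> y \<in> H"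
proof -
  have "H #> x = H #> y \<longleftrightarrow> y \<in> H #> x"
    using assms by (metis repr_independence rcos_self subgroup_axioms)
  also have "\<dots> \<longleftrightarrow> y \<in> x <# H"
    using coset_eq assms by simp
  also have "\<dots> \<longleftrightarrow> inv x \<otimes> y \<in> H"
  proof
    assume "y \<in> x <# H"
    then obtain h where "h \<in> H" "y = x \<otimes> h" by (auto simp: l_coset_def)
    then show "inv x \<otimes> y \<in> H"
      using assms subset by (auto simp flip: m_assoc)
  next
    assume "inv x \<otimes> y \<in> H"
    moreover have "x \<otimes> (inv x \<otimes> y) = y"
      using assms by (simp flip: m_assoc)
    ultimately show "y \<in> x <# H"
      unfolding l_coset_def by (metis UN_I singletonI)
  qed
  finally show ?thesis .
qed

text \<open>By normality the saturation of \<open>U\<close> is the union of the right translates of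
  \<open>U\<close> by elements of \<open>H\<close>, so continuity of right translations
  suffices.\<close>

lemma open_map_quotient_space: "open_map T quotient_space (\<lambda>x. H #> x)"
  unfolding open_map_def
proof (intro allI impI)
  fix U assume U: "openin T U"
  have Uc: "U \<subseteq> carrier G" using openin_subset[OF U] topspace_eq_carrier by simp
  have "{x \<in> topspace T. H #> x \<in> (#>) H ` U} = (\<Union>h\<in>H. U #> h)"
  proof (intro equalityI subsetI)
    fix x assume "x \<in> {x \<in> topspace T. H #> x \<in> (#>) H ` U}"
    then obtain u where u: "u \<in> U" "x \<in> carrier G" "H #> u = H #> x"
      by (auto simp: topspace_eq_carrier)
    then have "inv u \<otimes> x \<in> H" "u \<otimes> (inv u \<otimes> x) = x"
      using Uc r_coset_eq_iff[of u x] by (auto simp flip: m_assoc)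
    then show "x \<in> (\<Union>h\<in>H. U #> h)"
      using u by (force simp: r_coset_def)
  next
    fix x assume "x \<in> (\<Union>h\<in>H. U #> h)"
    then obtain h u where hu: "h \<in> H" "u \<in> U" "x = u \<otimes> h" by (auto simp: r_coset_def)
    then have c: "h \<in> carrier G" "u \<in> carrier G" using Uc subset by auto
    then have "inv u \<otimes> x = h" using hu by (simp flip: m_assoc)
    then have "H #> u = H #> x" using c hu r_coset_eq_iff[of u x] by simp
    then show "x \<in> {x \<in> topspace T. H #> x \<in> (#>) H ` U}"
      using c hu by (auto simp: topspace_eq_carrier)
  qed
  moreover have "openin T (\<Union>h\<in>H. U #> h)"
    using U subset by (intro openin_Union) (auto intro: openin_r_coset)
  ultimately show "openin quotient_space ((#>) H ` U)"
    using Uc unfolding quotient_space_def openin_quotient_topology topspace_eq_carrier by auto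
qed

text \<open>The relation of lying in the same coset is the preimage of \<open>H\<close> under
  \<open>(x, y) \<mapsto> inv x \<otimes> y\<close>, which is continuous into \<sigma>.\<close>

lemma Hausdorff_space_quotient_space:
  assumes "closedin (sigma_topology G T) H"
  shows "Hausdorff_space quotient_space"
proof (rule Hausdorff_space_open_map_image[OF open_map_quotient_space])
  show "(#>) H ` topspace T = topspace quotient_space"
    by (simp add: quotient_space_def)
  have "closedin (prod_topology T T) {p \<in> topspace (prod_topology T T). (\<lambda>(x, y). inv x \<otimes> y) p \<in> H}"
    using quotient_imp_continuous_map[OF quotient_map_sigma_topology] assms
    by (rule closedin_continuous_map_preimage)
  moreover have "{p \<in> topspace (prod_topology T T). (\<lambda>(x, y). inv x \<otimes> y) p \<in> H} =
    {(x, y). x \<in> topspace T \<and> y \<in> topspace T \<and> H #> x = H #> y}"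
    by (auto simp: topspace_eq_carrier simp flip: r_coset_eq_iff)
  ultimately show "closedin (prod_topology T T) {(x, y). x \<in> topspace T \<and> y \<in> topspace T \<and> H #> x = H #> y}"
    by simp
qed

lemma right_topological_group_quotient_space:
  "right_topological_group (G Mod H) quotient_space"
proof -
  interpret Q: group "G Mod H" by (rule factorgroup_is_group)
  show ?thesis
  proof
    show "topspace quotient_space = carrier (G Mod H)" by (rule topspace_quotient_space)
    fix A assume "A \<in> carrier (G Mod H)"
    then obtain g where g: "g \<in> carrier G" "A = H #> g" by (auto simp: carrier_FactGroup)
    have "continuous_map T quotient_space ((\<lambda>x. H #> x) \<circ> (\<lambda>x. x \<otimes> g))"
      using continuous_map_compose[OF continuous_right_mult[OF g(1)]
          quotient_imp_continuous_map[OF quotient_map_quotient_space]] .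
    then have "continuous_map T quotient_space ((\<lambda>B. B \<otimes>\<^bsub>G Mod H\<^esub> A) \<circ> (\<lambda>x. H #> x))"
      by (rule continuous_map_eq) (use g in \<open>auto simp: topspace_eq_carrier rcos_sum\<close>)
    then show "continuous_map quotient_space quotient_space (\<lambda>B. B \<otimes>\<^bsub>G Mod H\<^esub> A)"
      by (rule continuous_compose_quotient_map[OF quotient_map_quotient_space])
  qed
qed

lemma locally_compact_space_quotient_space:
  assumes "locally_compact_space T" shows "locally_compact_space quotient_space"
  using quotient_imp_continuous_map[OF quotient_map_quotient_space] open_map_quotient_space
    quotient_imp_surjective_map[OF quotient_map_quotient_space] assms
  by (rule locally_compact_space_continuous_open_map_image)

lemma sigma_compact_space_quotient_space:
  assumes "sigma_compact_space T" shows "sigma_compact_space quotient_space"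
proof -
  obtain K :: "nat \<Rightarrow> 'a set" where K: "\<And>n. compactin T (K n)" "topspace T = (\<Union>n. K n)"
    using assms unfolding sigma_compact_space_def by blast
  show ?thesis
    unfolding sigma_compact_space_def
  proof (intro exI conjI allI)
    show "compactin quotient_space ((#>) H ` K n)" for n
      using K quotient_imp_continuous_map[OF quotient_map_quotient_space] by (intro image_compactin)
    show "topspace quotient_space = (\<Union>n. (#>) H ` K n)"
      by (auto simp: quotient_space_def K)
  qed
qed

text \<open>Each coset of \<open>H\<close> is compact and lies in a member of a compact exhaustion.
  Baire makes the choice of the member uniform over an open set \<open>W\<close> of cosets; finitely
  many translates of \<open>W\<close> cover \<open>C\<close>, so the closed preimage of
  \<open>C\<close> lies in finitely many translates of one compact set.\<close>

lemma compactin_quotient_preimage: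
  assumes T: "locally_compact_space T" "Hausdorff_space T" "sigma_compact_space T"
    and Q: "Hausdorff_space quotient_space" and H: "compactin T H" and C: "compactin quotient_space C"
  shows "compactin T {x \<in> carrier G. H #> x \<in> C}"
proof -
  interpret Q: right_topological_group "G Mod H" quotient_space
    by (rule right_topological_group_quotient_space)
  obtain L :: "nat \<Rightarrow> 'a set" where L: "\<And>n. compactin T (L n)" "topspace T = (\<Union>n. L n)"
    using T unfolding sigma_compact_space_def by blast
  \<comment> \<open>The open sets between \<open>L n\<close> and \<open>K n\<close> ensure that
    every compact set lies in a single \<open>E n\<close>.\<close>
  have "\<exists>U K. openin T U \<and> compactin T K \<and> L n \<subseteq> U \<and> U \<subseteq> K" for n
    using T L(1)[of n] locally_compact_space_compact_closed_compact[of T] by metis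
  then obtain U K where UK: "\<And>n. openin T (U n)" "\<And>n. compactin T (K n)" "\<And>n. L n \<subseteq> U n" "\<And>n. U n \<subseteq> K n"
    by metis
  define E where "E n = (\<Union>i\<le>n. K i)" for n
  have E: "compactin T (E n)" for n
    unfolding E_def by (intro compactin_Union) (auto simp: UK)
  have absorb: "\<exists>n. D \<subseteq> E n" if D: "compactin T D" for D
  proof -
    have "D \<subseteq> \<Union>(range U)"
      using compactin_subset_topspace[OF D] UK(3) unfolding L(2) by blast
    then obtain \<F> where F: "finite \<F>" "\<F> \<subseteq> range U" "D \<subseteq> \<Union>\<F>"
      using compactinD[OF D, of "range U"] UK(1) by blast
    then obtain I where I: "finite I" "\<F> = U ` I" by (meson finite_subset_image)
    then obtain n where "\<And>i. i \<in> I \<Longrightarrow> i \<le> n" by (meson finite_nat_set_iff_bounded_le)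
    then have "(\<Union>i\<in>I. U i) \<subseteq> E n" using UK(4) unfolding E_def by blast
    then have "D \<subseteq> E n" using F(3) I(2) by blast
    then show ?thesis ..
  qed
  \<comment> \<open>The cosets that lie entirely in \<open>E n\<close>; this set is closed because
    the projection is open.\<close>
  define A where "A n = topspace quotient_space - (#>) H ` (topspace T - E n)" for n
  have "\<exists>n. quotient_space interior_of (A n) \<noteq> {}"
  proof -
    have "closedin quotient_space (A n)" for n
    proof -
      have "openin T (topspace T - E n)"
        using compactin_imp_closedin[OF T(2) E] by auto
      then show ?thesis
        using open_map_quotient_space by (auto simp: A_def open_map_def)
    qed
    moreover have "topspace quotient_space = (\<Union>n. A n)"
    proof -
      have "\<exists>n. y \<in> A n" if y: "y \<in> topspace quotient_space" for y
      proof -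
        obtain x where x: "x \<in> carrier G" "y = H #> x"
          using y by (auto simp: topspace_quotient_space carrier_FactGroup)
        obtain n where n: "H #> x \<subseteq> E n"
          using absorb compactin_r_coset[OF H x(1)] by metis
        have "H #> x \<noteq> H #> z" if "z \<in> topspace T - E n" for z
          using that n rcos_self[OF _ subgroup_axioms, of z] by (auto simp: topspace_eq_carrier)
        then have "y \<in> A n" using x y by (auto simp: A_def)
        then show ?thesis ..
      qed
      then show ?thesis by (auto simp: A_def)
    qed
    moreover have "topspace quotient_space \<noteq> {}"
      unfolding topspace_quotient_space by (auto simp: carrier_FactGroup)
    ultimately show ?thesis
      using interior_nonempty_of_countable_closed_cover[OF locally_compact_space_quotient_space[OF T(1)] Q]
      by metis
  qed
  then obtain n w where w: "w \<in> quotient_space interior_of (A n)" by auto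
  define W where "W = quotient_space interior_of (A n)"
  have W: "openin quotient_space W" "W \<subseteq> A n" "w \<in> W" "w \<in> carrier (G Mod H)"
    using w interior_of_subset_topspace[of quotient_space "A n"]
    by (auto simp: W_def interior_of_subset topspace_quotient_space)
  have in_E: "x \<in> E n" if "x \<in> carrier G" "H #> x \<in> W" for x
    using W(2) that by (auto simp: A_def topspace_eq_carrier)
  obtain w' where w': "w' \<in> carrier G" "w = H #> w'"
    using W(4) by (auto simp: carrier_FactGroup)
  let ?W = "\<lambda>g. W #>\<^bsub>G Mod H\<^esub> (H #> g)"
  have open_W: "openin quotient_space (?W g)" if "g \<in> carrier G" for g
    using that by (intro Q.openin_r_coset W) (auto simp: carrier_FactGroup)
  have "C \<subseteq> \<Union>(?W ` carrier G)"
  proof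
    fix y assume "y \<in> C"
    then obtain x where x: "x \<in> carrier G" "y = H #> x"
      using compactin_subset_topspace[OF C] by (auto simp: topspace_quotient_space carrier_FactGroup)
    then have "w' \<otimes> (inv w' \<otimes> x) = x" using w' by (simp flip: m_assoc)
    then have "y = w \<otimes>\<^bsub>G Mod H\<^esub> (H #> (inv w' \<otimes> x))"
      using x w' by (simp add: rcos_sum)
    then have "y \<in> ?W (inv w' \<otimes> x)" using W by (auto simp: r_coset_def)
    then show "y \<in> \<Union>(?W ` carrier G)" using x(1) w'(1) by (intro UN_I) auto
  qed
  then have "\<exists>\<F>. finite \<F> \<and> \<F> \<subseteq> ?W ` carrier G \<and> C \<subseteq> \<Union>\<F>"
    using open_W by (intro compactinD[OF C]) auto
  then obtain F where F: "finite F" "F \<subseteq> carrier G" "C \<subseteq> \<Union>(?W ` F)"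
    by (metis finite_subset_image)
  have "{x \<in> carrier G. H #> x \<in> C} \<subseteq> (\<Union>g\<in>F. E n #> g)"
  proof
    fix x assume "x \<in> {x \<in> carrier G. H #> x \<in> C}"
    then have x: "x \<in> carrier G" and "H #> x \<in> (\<Union>g\<in>F. ?W g)"
      using F(3) by auto
    then obtain g where "g \<in> F" "H #> x \<in> ?W g" by (meson UN_E)
    then have g: "g \<in> F" "g \<in> carrier G" "H #> x \<in> ?W g" using F(2) by auto
    then obtain v where v: "v \<in> W" "H #> x = v \<otimes>\<^bsub>G Mod H\<^esub> (H #> g)"
      by (auto simp: r_coset_def)
    then obtain v' where v': "v' \<in> carrier G" "v = H #> v'"
      using openin_subset[OF W(1)] by (auto simp: topspace_quotient_space carrier_FactGroup)
    have "H #> x = H #> (v' \<otimes> g)" using v v' g by (simp add: rcos_sum)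
    then have "(H #> x) #> inv g = (H #> (v' \<otimes> g)) #> inv g" by simp
    then have "H #> (x \<otimes> inv g) = H #> v'"
      using x g v'(1) subset by (simp add: coset_mult_assoc m_assoc)
    then have "x \<otimes> inv g \<in> E n"
      using in_E[of "x \<otimes> inv g"] v v' x g by auto
    moreover have "x = (x \<otimes> inv g) \<otimes> g" using x g by (simp add: m_assoc)
    ultimately have "x \<in> E n #> g" unfolding r_coset_eq_image by (rule rev_image_eqI)
    then show "x \<in> (\<Union>g\<in>F. E n #> g)" using g(1) by (rule UN_I[rotated])
  qed
  moreover have "compactin T (\<Union>g\<in>F. E n #> g)"
    using F E by (intro compactin_Union) (auto intro: compactin_r_coset)
  moreover have "closedin T {x \<in> topspace T. H #> x \<in> C}"
    using quotient_imp_continuous_map[OF quotient_map_quotient_space] compactin_imp_closedin[OF Q C]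
    by (rule closedin_continuous_map_preimage)
  ultimately show ?thesis
    unfolding topspace_eq_carrier by (metis (no_types, lifting) closed_compactin)
qed

text \<open>\<open>(x, y) \<mapsto> inv x \<otimes> y\<close> followed by the projection is
  continuous into the quotient of \<sigma> by the very definition of \<sigma>. Once that quotient is
  identified with the quotient of \<tau>, the map descends to \<open>G Mod H\<close> in both
  variables.\<close>

theorem locally_compact_topological_group_quotient_space:
  assumes T: "locally_compact_space T" "sigma_compact_space T"
    and G: "admissible G T \<or> compact_space T"
    and H: "closedin (sigma_sigma_topology G T) H"
  shows "locally_compact_topological_group (G Mod H) quotient_space"
proof -
  let ?\<sigma> = "sigma_topology G T"
  interpret \<sigma>: right_topological_group_normal G ?\<sigma> H
    by (intro right_topological_group_normal.intro right_topological_group_sigma_topology normal_axioms)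
  interpret Q: right_topological_group "G Mod H" quotient_space
    by (rule right_topological_group_quotient_space)
  have H\<sigma>: "closedin (sigma_topology G ?\<sigma>) H"
    using H by (simp add: sigma_sigma_topology_def)
  then have "closedin ?\<sigma> H"
    using \<sigma>.openin_sigma_topology_imp_openin topspace_sigma_topology[OF topspace_eq_carrier]
      topspace_sigma_sigma_topology
    by (auto simp: closedin_def sigma_sigma_topology_def)
  then have HQ: "Hausdorff_space quotient_space"
    by (rule Hausdorff_space_quotient_space)
  have H\<sigma>Q: "Hausdorff_space \<sigma>.quotient_space"
    using H\<sigma> by (rule \<sigma>.Hausdorff_space_quotient_space)
  \<comment> \<open>In the admissible case \<sigma> itself is locally compact, as an open continuous
    image. In the compact case the argument runs on the quotient, where Hausdorffness is
    available.\<close>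
  have lc: "locally_compact_space \<sigma>.quotient_space"
    using G
  proof
    assume "admissible G T"
    from open_map_sigma_topology[OF this] have "locally_compact_space ?\<sigma>"
      using quotient_map_sigma_topology T(1)
      by (metis locally_compact_space_continuous_open_map_image locally_compact_space_prod_topology
          quotient_imp_continuous_map quotient_imp_surjective_map)
    then show ?thesis by (rule \<sigma>.locally_compact_space_quotient_space)
  next
    assume "compact_space T"
    then have "compactin (prod_topology T T) (topspace (prod_topology T T))"
      by (metis compact_space_def compact_space_prod_topology)
    then have "compactin ?\<sigma> (topspace ?\<sigma>)"
      using quotient_map_sigma_topology
      by (metis image_compactin quotient_imp_continuous_map quotient_imp_surjective_map)
    then have "compactin \<sigma>.quotient_space (topspace \<sigma>.quotient_space)"
      using \<sigma>.quotient_map_quotient_space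
      by (metis image_compactin quotient_imp_continuous_map quotient_imp_surjective_map)
    then have "compact_space \<sigma>.quotient_space"
      by (simp add: compact_space_def)
    then show ?thesis
      using H\<sigma>Q by (intro compact_imp_locally_compact_space) auto
  qed
  have eq: "\<sigma>.quotient_space = quotient_space"
  proof (rule Q.topology_eq_coarser_locally_compact[OF _ _ _ lc H\<sigma>Q])
    show "right_topological_group (G Mod H) \<sigma>.quotient_space"
      by (rule \<sigma>.right_topological_group_quotient_space)
    show "sigma_compact_space quotient_space"
      by (rule sigma_compact_space_quotient_space[OF T(2)])
    fix U assume "openin \<sigma>.quotient_space U"
    then show "openin quotient_space U"
      using openin_sigma_topology_imp_openin
      by (auto simp: \<sigma>.quotient_space_def quotient_space_def openin_quotient_topology
          topspace_eq_carrier \<sigma>.topspace_eq_carrier)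
  qed
  let ?\<pi> = "\<lambda>x. H #> x"
  \<comment> \<open>A product of quotient maps need not be a quotient map; here openness of the
    projection makes it one.\<close>
  have "quotient_map (prod_topology T T) (prod_topology quotient_space quotient_space) (\<lambda>(x, y). (?\<pi> x, ?\<pi> y))"
  proof (rule continuous_open_imp_quotient_map)
    show "continuous_map (prod_topology T T) (prod_topology quotient_space quotient_space) (\<lambda>(x, y). (?\<pi> x, ?\<pi> y))"
      using quotient_imp_continuous_map[OF quotient_map_quotient_space] by (simp add: continuous_map_prod_top)
    show "open_map (prod_topology T T) (prod_topology quotient_space quotient_space) (\<lambda>(x, y). (?\<pi> x, ?\<pi> y))"
      by (intro open_map_prod open_map_quotient_space)
    show "(\<lambda>(x, y). (?\<pi> x, ?\<pi> y)) ` topspace (prod_topology T T) = topspace (prod_topology quotient_space quotient_space)"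
      by (auto simp: quotient_space_def image_iff)
  qed
  moreover have "continuous_map (prod_topology T T) quotient_space
      ((\<lambda>(A, B). inv\<^bsub>G Mod H\<^esub> A \<otimes>\<^bsub>G Mod H\<^esub> B) \<circ> (\<lambda>(x, y). (?\<pi> x, ?\<pi> y)))"
  proof -
    have "continuous_map (prod_topology T T) quotient_space (?\<pi> \<circ> (\<lambda>(x, y). inv x \<otimes> y))"
      using continuous_map_compose[OF quotient_imp_continuous_map[OF quotient_map_sigma_topology]
          quotient_imp_continuous_map[OF \<sigma>.quotient_map_quotient_space]] by (simp only: eq)
    then show ?thesis
      by (rule continuous_map_eq)
        (auto simp: topspace_eq_carrier inv_FactGroup carrier_FactGroup rcos_inv rcos_sum)
  qed
  ultimately have "continuous_map (prod_topology quotient_space quotient_space) quotient_space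
      (\<lambda>(A, B). inv\<^bsub>G Mod H\<^esub> A \<otimes>\<^bsub>G Mod H\<^esub> B)"
    by (rule continuous_compose_quotient_map)
  then show ?thesis
    using HQ locally_compact_space_quotient_space[OF T(1)]
    by unfold_locales
qed

end

subsection \<open>Lifting Radon measures\<close>

text \<open>For finitely many sets of \<open>N\<close>, place the mass of each atom of the algebra that they generate at one
  point of its preimage; then take a cluster point over all finite families.\<close>

lemma finitely_additive_lift:
  fixes N :: "'b measure" and f :: "'a \<Rightarrow> 'b" and \<Omega> :: "'a set"
  assumes f: "f ` \<Omega> = space N"
  obtains a :: "'a set \<Rightarrow> ennreal"
  where "\<And>A B. disjnt A B \<Longrightarrow> a (A \<union> B) = a A + a B"
    and "\<And>B. B \<in> sets N \<Longrightarrow> a {x \<in> \<Omega>. f x \<in> B} = emeasure N B"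
proof -
  define atom where "atom \<B> S = {y \<in> space N. \<forall>B\<in>\<B>. y \<in> B \<longleftrightarrow> B \<in> S}" for \<B> S
  define p where "p \<B> S = inv_into \<Omega> f (SOME y. y \<in> atom \<B> S)" for \<B> S
  \<comment> \<open>\<open>p\<close> selects no meaningful point for an empty atom, so such atoms
    are left out. Atoms of infinite mass are allowed.\<close>
  define \<psi> where "\<psi> \<B> A = (\<Sum>S\<in>{S\<in>Pow \<B>. atom \<B> S \<noteq> {}}. emeasure N (atom \<B> S) * indicator A (p \<B> S))" for \<B> A
  have p: "p \<B> S \<in> \<Omega>" "f (p \<B> S) \<in> atom \<B> S" if "atom \<B> S \<noteq> {}" for \<B> S
  proof -
    have "(SOME y. y \<in> atom \<B> S) \<in> atom \<B> S"
      using that by (simp add: some_in_eq)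
    moreover from this have "(SOME y. y \<in> atom \<B> S) \<in> f ` \<Omega>"
      unfolding f by (auto simp: atom_def)
    ultimately show "p \<B> S \<in> \<Omega>" "f (p \<B> S) \<in> atom \<B> S"
      unfolding p_def by (auto simp: inv_into_into f_inv_into_f)
  qed
  have atom_sets: "atom \<B> S \<in> sets N" if "finite \<B>" "\<B> \<noteq> {}" "\<B> \<subseteq> sets N" for \<B> S
    unfolding atom_def
  proof (rule sets.sets_Collect_finite_All')
    fix B assume "B \<in> \<B>"
    then have B: "B \<in> sets N" using that by auto
    have "{y \<in> space N. y \<in> B \<longleftrightarrow> B \<in> S} = (if B \<in> S then B else space N - B)"
      using sets.sets_into_space[OF B] by auto
    then show "{y \<in> space N. y \<in> B \<longleftrightarrow> B \<in> S} \<in> sets N"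
      using B by auto
  qed (use that in auto)
  have lift: "\<psi> \<B> {x \<in> \<Omega>. f x \<in> B} = emeasure N B" if \<B>: "finite \<B>" "\<B> \<subseteq> sets N" "B \<in> \<B>" for \<B> B
  proof -
    have fin: "finite (Pow \<B>)" using \<B> by simp
    have "\<psi> \<B> {x \<in> \<Omega>. f x \<in> B} = (\<Sum>S\<in>{S\<in>Pow \<B>. atom \<B> S \<noteq> {}}. if B \<in> S then emeasure N (atom \<B> S) else 0)"
      unfolding \<psi>_def
    proof (rule sum.cong[OF refl])
      fix S assume "S \<in> {S\<in>Pow \<B>. atom \<B> S \<noteq> {}}"
      then have "p \<B> S \<in> \<Omega>" "f (p \<B> S) \<in> B \<longleftrightarrow> B \<in> S"
        using p[of \<B> S] \<B>(3) by (auto simp: atom_def)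
      then show "emeasure N (atom \<B> S) * indicator {x \<in> \<Omega>. f x \<in> B} (p \<B> S)
          = (if B \<in> S then emeasure N (atom \<B> S) else 0)"
        by (simp add: indicator_def)
    qed
    \<comment> \<open>The empty atoms return at no cost, having measure 0, and the index set now
      describes a partition of \<open>B\<close>.\<close>
    also have "\<dots> = (\<Sum>S\<in>{S\<in>Pow \<B>. B \<in> S}. emeasure N (atom \<B> S))"
      using fin by (intro sum.mono_neutral_cong) auto
    also have "\<dots> = emeasure N (\<Union>S\<in>{S\<in>Pow \<B>. B \<in> S}. atom \<B> S)"
    proof (rule sum_emeasure)
      show "atom \<B> ` {S \<in> Pow \<B>. B \<in> S} \<subseteq> sets N" using atom_sets[OF \<B>(1) _ \<B>(2)] \<B>(3) by auto
      show "disjoint_family_on (atom \<B>) {S \<in> Pow \<B>. B \<in> S}"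
        unfolding disjoint_family_on_def atom_def by blast
    qed (use fin in auto)
    also have "(\<Union>S\<in>{S\<in>Pow \<B>. B \<in> S}. atom \<B> S) = B"
    proof (intro equalityI subsetI)
      fix y assume y: "y \<in> B"
      then have "y \<in> atom \<B> {C\<in>\<B>. y \<in> C}"
        using sets.sets_into_space[of B N] \<B> by (auto simp: atom_def)
      then show "y \<in> (\<Union>S\<in>{S\<in>Pow \<B>. B \<in> S}. atom \<B> S)"
        using y \<B>(3) by (intro UN_I[of "{C\<in>\<B>. y \<in> C}"]) auto
    qed (use \<B>(3) in \<open>auto simp: atom_def\<close>)
    finally show ?thesis .
  qed
  obtain a where a: "\<And>C. closed C \<Longrightarrow> (\<forall>\<^sub>F \<B> in finite_subsets_at_top (sets N). \<psi> \<B> \<in> C) \<Longrightarrow> a \<in> C"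
    using ennreal_fun_cluster_point[OF finite_subsets_at_top_neq_bot, where \<psi> = \<psi>] by metis
  show thesis
  proof
    fix A B :: "'a set" assume "disjnt A B"
    have "a \<in> {a. a (A \<union> B) = a A + a B}"
    proof (rule a)
      have "indicator (A \<union> B) x = (indicator A x + indicator B x :: ennreal)" for x
        using \<open>disjnt A B\<close> by (auto simp: disjnt_iff indicator_def)
      then have "\<psi> \<B> (A \<union> B) = \<psi> \<B> A + \<psi> \<B> B" for \<B>
        unfolding \<psi>_def by (simp add: distrib_left sum.distrib)
      then show "\<forall>\<^sub>F \<B> in finite_subsets_at_top (sets N). \<psi> \<B> \<in> {a. a (A \<union> B) = a A + a B}"
        by simp
    qed (intro closed_Collect_eq continuous_intros continuous_on_product_coordinates)
    then show "a (A \<union> B) = a A + a B" by simp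
  next
    fix B assume B: "B \<in> sets N"
    have "a \<in> {a. a {x \<in> \<Omega>. f x \<in> B} = emeasure N B}"
    proof (rule a)
      show "\<forall>\<^sub>F \<B> in finite_subsets_at_top (sets N). \<psi> \<B> \<in> {a. a {x \<in> \<Omega>. f x \<in> B} = emeasure N B}"
        unfolding eventually_finite_subsets_at_top
        using B by (intro exI[of _ "{B}"]) (auto intro!: lift)
    qed (intro closed_Collect_eq continuous_intros continuous_on_product_coordinates)
    then show "a {x \<in> \<Omega>. f x \<in> B} = emeasure N B" by simp
  qed
qed

lemma emeasure_compactin_finite: "radon_measure X M \<Longrightarrow> compactin X K \<Longrightarrow> emeasure M K < \<infinity>"
  unfolding radon_measure_def by blast

lemma sets_radon_measure: "radon_measure X M \<Longrightarrow> sets M = sets (borel_of X)"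
  unfolding radon_measure_def by blast

lemma space_radon_measure: "radon_measure X M \<Longrightarrow> space M = topspace X"
  unfolding radon_measure_def by blast

text \<open>The lift \<open>a\<close> is finitely additive on all subsets of the space but perhaps
  not countably additive, so it serves only as a content. Inner regularity of \<open>N\<close> and
  compactness of preimages recover the values over open sets, and complements those over compact
  sets.\<close>

theorem ex_radon_measure_lift:
  assumes X: "locally_compact_space X" "Hausdorff_space X"
    and Y: "locally_compact_space Y" "Hausdorff_space Y"
    and f: "continuous_map X Y f" "f ` topspace X = topspace Y"
    and proper: "\<And>C. compactin Y C \<Longrightarrow> compactin X {x \<in> topspace X. f x \<in> C}"
    and N: "radon_measure Y N"
  shows "\<exists>M. radon_measure X M \<and>
    (\<forall>U. openin Y U \<longrightarrow> emeasure M {x \<in> topspace X. f x \<in> U} = emeasure N U) \<and>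
    (\<forall>C. compactin Y C \<longrightarrow> emeasure M {x \<in> topspace X. f x \<in> C} = emeasure N C)"
proof -
  have "f ` topspace X = space N" using f(2) by (simp add: space_radon_measure[OF N])
  then obtain a :: "'a set \<Rightarrow> ennreal"
  where add: "\<And>A B. disjnt A B \<Longrightarrow> a (A \<union> B) = a A + a B"
    and lift: "\<And>B. B \<in> sets N \<Longrightarrow> a {x \<in> topspace X. f x \<in> B} = emeasure N B"
    using finitely_additive_lift[of f "topspace X" N] by metis
  have mono: "a A \<le> a B" if "A \<subseteq> B" for A B
  proof -
    have "a B = a A + a (B - A)"
      using add[of A "B - A"] that by (simp add: Un_absorb1 disjnt_def)
    then show ?thesis by simp
  qed
  have setsN: "openin Y U \<Longrightarrow> U \<in> sets N" "compactin Y C \<Longrightarrow> C \<in> sets N" for U C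
    using Y by (simp_all add: sets_radon_measure[OF N] openin_sets_borel_of compactin_sets_borel_of)
  interpret compact_content X a
  proof
    fix K assume K: "compactin X K"
    have fK: "compactin Y (f ` K)" using K f(1) by (rule image_compactin)
    have "a K \<le> a {x \<in> topspace X. f x \<in> f ` K}"
      using compactin_subset_topspace[OF K] by (intro mono) auto
    also have "\<dots> = emeasure N (f ` K)"
      using fK setsN by (intro lift) auto
    also have "\<dots> < \<infinity>"
      by (rule emeasure_compactin_finite[OF N fK])
    finally show "a K < \<infinity>" .
  next
    fix K L :: "'a set"
    have "a (K \<union> L) = a K + a (L - K)"
      using add[of K "L - K"] by (simp add: disjnt_def)
    also have "\<dots> \<le> a K + a L"
      by (intro add_left_mono mono) auto
    finally show "a (K \<union> L) \<le> a K + a L" .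
  qed (use X mono add in auto)
  have setsM: "{x \<in> topspace X. f x \<in> B} \<in> sets content_measure" if "B \<in> sets N" for B
  proof -
    have "f -` B \<inter> space (borel_of X) \<in> sets (borel_of X)"
      using that by (intro measurable_sets[OF measurable_continuous_map[OF f(1)]])
        (simp add: sets_radon_measure[OF N])
    then show ?thesis by (simp add: sets_content_measure vimage_def Int_def conj_commute)
  qed
  have opens: "emeasure content_measure {x \<in> topspace X. f x \<in> U} = emeasure N U"
    if U: "openin Y U" for U
  proof (rule antisym)
    have op: "openin X {x \<in> topspace X. f x \<in> U}"
      using f(1) U by (simp add: continuous_map_def)
    show "emeasure content_measure {x \<in> topspace X. f x \<in> U} \<le> emeasure N U"
      unfolding emeasure_content_measure_open[OF op]
    proof (rule SUP_least)
      fix K assume "K \<in> {K. compactin X K \<and> K \<subseteq> {x \<in> topspace X. f x \<in> U}}"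
      then have "a K \<le> a {x \<in> topspace X. f x \<in> U}" by (intro mono) simp
      then show "a K \<le> emeasure N U" using U setsN by (simp add: lift)
    qed
    have "emeasure N U = (SUP K\<in>{K. compactin Y K \<and> K \<subseteq> U}. emeasure N K)"
      using N U unfolding radon_measure_def by blast
    also have "\<dots> \<le> emeasure content_measure {x \<in> topspace X. f x \<in> U}"
    proof (rule SUP_least)
      fix K assume "K \<in> {K. compactin Y K \<and> K \<subseteq> U}"
      then have K: "compactin Y K" "K \<subseteq> U" by auto
      have "emeasure N K = a {x \<in> topspace X. f x \<in> K}"
        using K setsN by (simp add: lift)
      also have "\<dots> \<le> emeasure content_measure {x \<in> topspace X. f x \<in> U}"
        unfolding emeasure_content_measure_open[OF op]
        using K by (intro SUP_upper) (auto intro: proper)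
      finally show "emeasure N K \<le> emeasure content_measure {x \<in> topspace X. f x \<in> U}" .
    qed
    finally show "emeasure N U \<le> emeasure content_measure {x \<in> topspace X. f x \<in> U}" .
  qed
  have compacts: "emeasure content_measure {x \<in> topspace X. f x \<in> C} = emeasure N C"
    if C: "compactin Y C" for C
  proof -
    \<comment> \<open>An open \<open>U\<close> inside a compact set has finite measure, so the known
      value over \<open>U - C\<close> can be cancelled.\<close>
    obtain U D where UD: "openin Y U" "compactin Y D" "C \<subseteq> U" "U \<subseteq> D"
      using Y C locally_compact_space_compact_closed_compact[of Y] by metis
    have UC: "openin Y (U - C)" "U - C \<in> sets N" "C \<in> sets N"
      using UD C Y setsN compactin_imp_closedin[of Y C] by auto
    have "emeasure N C + emeasure N (U - C) = emeasure N U"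
      using UC UD by (subst plus_emeasure) (auto simp: Un_absorb1)
    also have "\<dots> = emeasure content_measure {x \<in> topspace X. f x \<in> U}"
      using UD by (simp add: opens)
    also have "\<dots> = emeasure content_measure
        ({x \<in> topspace X. f x \<in> C} \<union> {x \<in> topspace X. f x \<in> U - C})"
      using UD by (intro arg_cong[where f = "emeasure content_measure"]) auto
    also have "\<dots> = emeasure content_measure {x \<in> topspace X. f x \<in> C}
        + emeasure content_measure {x \<in> topspace X. f x \<in> U - C}"
      by (rule plus_emeasure[symmetric]) (use setsM[OF UC(2)] setsM[OF UC(3)] in auto)
    also have "emeasure content_measure {x \<in> topspace X. f x \<in> U - C} = emeasure N (U - C)"
      using UC(1) by (rule opens)
    finally have "emeasure N C + emeasure N (U - C)
        = emeasure content_measure {x \<in> topspace X. f x \<in> C} + emeasure N (U - C)" .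
    moreover have "emeasure N (U - C) < \<infinity>"
      using emeasure_compactin_finite[OF N UD(2)] emeasure_mono[of "U - C" D N] UD setsN(2)[OF UD(2)]
      by (metis (no_types) Diff_subset le_less_trans subset_trans)
    ultimately show ?thesis
      by (auto simp: add.commute[of _ "emeasure N (U - C)"] ennreal_add_left_cancel)
  qed
  show ?thesis
    by (intro exI[of _ content_measure] conjI allI impI radon_measure_content_measure opens compacts)
qed

section \<open>Saturated sets and the lifted measure\<close>

context right_topological_group_normal
begin

definition saturated :: "'a set \<Rightarrow> bool" where
  "saturated A \<longleftrightarrow> A \<subseteq> carrier G \<and> (\<forall>h\<in>H. \<forall>x\<in>A. h \<otimes> x \<in> A)"

lemma r_coset_left_mult:
  assumes "h \<in> H" "x \<in> carrier G" shows "H #> (h \<otimes> x) = H #> x"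
  using assms subset by (metis coset_join2 coset_mult_assoc subgroup_axioms subsetD)

lemma saturated_preimage: "saturated {x \<in> carrier G. H #> x \<in> B}"
  using subset by (auto simp: saturated_def r_coset_left_mult)

lemma saturated_eq_preimage:
  assumes "saturated A" shows "{x \<in> carrier G. H #> x \<in> (#>) H ` A} = A"
proof (intro equalityI subsetI)
  fix x assume "x \<in> {x \<in> carrier G. H #> x \<in> (#>) H ` A}"
  then obtain y where y: "x \<in> carrier G" "y \<in> A" "H #> x = H #> y" by auto
  then have "x \<in> H #> y" using rcos_self[OF _ subgroup_axioms, of x] by simp
  then show "x \<in> A" using y(2) assms by (auto simp: r_coset_def saturated_def)
qed (use assms in \<open>auto simp: saturated_def\<close>)

lemma saturated_r_coset:
  assumes "saturated A" "g \<in> carrier G" shows "saturated (A #> g)"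
proof -
  have "\<exists>y\<in>A. h \<otimes> (x \<otimes> g) = y \<otimes> g" if "h \<in> H" "x \<in> A" for h x
  proof (rule bexI)
    have "h \<in> carrier G" "x \<in> carrier G" using that assms subset by (auto simp: saturated_def)
    then show "h \<otimes> (x \<otimes> g) = (h \<otimes> x) \<otimes> g" using assms by (simp add: m_assoc)
    show "h \<otimes> x \<in> A" using that assms by (simp add: saturated_def)
  qed
  then show ?thesis
    using assms by (auto simp: saturated_def r_coset_def)
qed

lemma r_coset_image_quotient:
  assumes "A \<subseteq> carrier G" "g \<in> carrier G"
  shows "(#>) H ` (A #> g) = ((#>) H ` A) #>\<^bsub>G Mod H\<^esub> (H #> g)"
proof -
  have "H #> (x \<otimes> g) = (H #> x) \<otimes>\<^bsub>G Mod H\<^esub> (H #> g)" if "x \<in> A" for x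
    using that assms by (simp add: rcos_sum subsetD)
  then show ?thesis by (auto simp: r_coset_def[of _ A] r_coset_def[of "G Mod H"])
qed

text \<open>A compact saturated set is the preimage of its compact image, so invariance is inherited
  from \<open>N\<close>. The image of a saturated Borel set is not known to be Borel, hence the
  approximation from inside by compact saturated sets takes place in \<open>G\<close>.\<close>

theorem ex_radon_measure_saturated_invariant:
  assumes T: "locally_compact_space T" "Hausdorff_space T" "sigma_compact_space T"
    and Q: "locally_compact_topological_group (G Mod H) quotient_space" and H: "compactin T H"
  shows "\<exists>M. radon_measure T M \<and> emeasure M (space M) \<noteq> 0 \<and>
    (\<forall>g\<in>carrier G. \<forall>E\<in>sets M. saturated E \<longrightarrow> emeasure M (E #> g) = emeasure M E)"
proof -
  interpret Q: locally_compact_topological_group "G Mod H" quotient_space by (rule Q)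
  let ?pre = "\<lambda>C. {x \<in> carrier G. H #> x \<in> C}"
  obtain N where N: "radon_measure quotient_space N" "emeasure N (space N) \<noteq> 0"
    and N_inv: "\<And>g E. g \<in> carrier (G Mod H) \<Longrightarrow> E \<in> sets N \<Longrightarrow> emeasure N (E #>\<^bsub>G Mod H\<^esub> g) = emeasure N E"
    using Q.ex_right_invariant_radon_measure by blast
  have proper: "compactin T (?pre C)" if "compactin quotient_space C" for C
    by (rule compactin_quotient_preimage[OF T Q.Hausdorff H that])
  have "\<exists>M. radon_measure T M \<and>
      (\<forall>U. openin quotient_space U \<longrightarrow> emeasure M (?pre U) = emeasure N U) \<and>
      (\<forall>C. compactin quotient_space C \<longrightarrow> emeasure M (?pre C) = emeasure N C)"
    by (rule ex_radon_measure_lift[OF T(1,2) Q.locally_compact Q.Hausdorff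
          quotient_imp_continuous_map[OF quotient_map_quotient_space]
          quotient_imp_surjective_map[OF quotient_map_quotient_space]
          proper[folded topspace_eq_carrier] N(1), unfolded topspace_eq_carrier])
  then obtain M where M: "radon_measure T M"
    and opens: "\<And>U. openin quotient_space U \<Longrightarrow> emeasure M (?pre U) = emeasure N U"
    and compacts: "\<And>C. compactin quotient_space C \<Longrightarrow> emeasure M (?pre C) = emeasure N C"
    by blast
  have space_M: "space M = carrier G"
    using space_radon_measure[OF M] by (simp add: topspace_eq_carrier)
  have image_compact: "compactin quotient_space ((#>) H ` C)" if "compactin T C" for C
    using that quotient_imp_continuous_map[OF quotient_map_quotient_space] by (rule image_compactin)
  have hull: "compactin T (?pre ((#>) H ` C))" "saturated (?pre ((#>) H ` C))" "C \<subseteq> ?pre ((#>) H ` C)"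
    if "compactin T C" for C
    using proper[OF image_compact[OF that]] saturated_preimage compactin_subset_topspace[OF that]
    by (auto simp: topspace_eq_carrier)
  have compact_sets: "C \<in> sets M" if "compactin T C" for C
    using that T(2) by (simp add: sets_radon_measure[OF M] compactin_sets_borel_of)
  have inv_compact: "emeasure M (C #> g) = emeasure M C"
    if C: "compactin T C" "saturated C" and g: "g \<in> carrier G" for C g
  proof -
    have Cc: "C \<subseteq> carrier G" using C by (simp add: saturated_def)
    have "emeasure M (C #> g) = emeasure M (?pre ((#>) H ` (C #> g)))"
      using C g by (simp add: saturated_eq_preimage saturated_r_coset)
    also have "\<dots> = emeasure N ((#>) H ` (C #> g))"
      using C g by (intro compacts image_compact compactin_r_coset)
    also have "\<dots> = emeasure N ((#>) H ` C)"
      unfolding r_coset_image_quotient[OF Cc g] using g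
      by (intro N_inv) (auto simp: carrier_FactGroup sets_radon_measure[OF N(1)]
          intro!: compactin_sets_borel_of image_compact C Q.Hausdorff)
    also have "\<dots> = emeasure M (?pre ((#>) H ` C))"
      using C by (intro compacts[symmetric] image_compact)
    also have "?pre ((#>) H ` C) = C"
      using C by (intro saturated_eq_preimage)
    finally show ?thesis .
  qed
  have le_bounded: "emeasure M E \<le> emeasure M (E #> g)"
    if E: "E \<in> sets M" "saturated E" "E \<subseteq> D" and D: "compactin T D" and g: "g \<in> carrier G" for E D g
  proof -
    have fin: "emeasure M D < \<infinity>" by (rule emeasure_compactin_finite[OF M D])
    have Eg: "E #> g \<in> sets M"
      using E g by (simp add: sets_radon_measure[OF M] sets_borel_of_r_coset)
    have DE: "D - E \<in> sets M" using E compact_sets[OF D] by auto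
    have "emeasure M D - emeasure M (E #> g) \<le> emeasure M U" if U: "openin T U" "D - E \<subseteq> U" for U
    proof -
      have U_sets: "U \<in> sets M" using U by (simp add: sets_radon_measure[OF M] openin_sets_borel_of)
      have "compactin T ((topspace T - U) \<inter> D)"
        using D U(1) by (intro closed_Int_compactin) auto
      moreover have "(topspace T - U) \<inter> D = D - U"
        using compactin_subset_topspace[OF D] by auto
      ultimately have K: "compactin T (D - U)" by simp
      \<comment> \<open>Outer regularity of \<open>D - E\<close> yields a compact set
        \<open>D - U\<close> inside \<open>E\<close>, which need not be saturated. Its saturation is
        still compact by properness and stays in \<open>E\<close> because \<open>E\<close> is
        saturated.\<close>
      let ?K = "?pre ((#>) H ` (D - U))"
      have "?K \<subseteq> ?pre ((#>) H ` E)" using U by auto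
      then have KE: "?K \<subseteq> E" using saturated_eq_preimage[OF E(2)] by simp
      have "emeasure M D \<le> emeasure M ((D - U) \<union> U)"
        using compact_sets[OF K] U_sets by (intro emeasure_mono sets.Un) auto
      also have "\<dots> \<le> emeasure M (D - U) + emeasure M U"
        using compact_sets[OF K] U_sets by (rule emeasure_subadditive)
      also have "emeasure M (D - U) \<le> emeasure M ?K"
        using hull[OF K] compact_sets by (intro emeasure_mono) auto
      also have "emeasure M ?K = emeasure M (?K #> g)"
        using hull[OF K] g by (simp add: inv_compact)
      also have "\<dots> \<le> emeasure M (E #> g)"
        using KE Eg by (intro emeasure_mono) (auto simp: r_coset_def)
      finally have "emeasure M D \<le> emeasure M (E #> g) + emeasure M U"
        by (simp add: add_right_mono)
      then show ?thesis
        using fin by (subst ennreal_minus_le_iff) auto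
    qed
    then have "emeasure M D - emeasure M (E #> g) \<le> (INF U\<in>{U. openin T U \<and> D - E \<subseteq> U}. emeasure M U)"
      by (intro INF_greatest) auto
    also have "\<dots> = emeasure M (D - E)"
      using M DE unfolding radon_measure_def by metis
    finally have "emeasure M D \<le> emeasure M (E #> g) + emeasure M (D - E)"
      using fin by (subst (asm) ennreal_minus_le_iff) auto
    moreover have "emeasure M D = emeasure M E + emeasure M (D - E)"
      using E DE by (subst plus_emeasure) (auto simp: Un_absorb1)
    moreover have "emeasure M (D - E) < \<infinity>"
      using fin emeasure_mono[of "D - E" D M] compact_sets[OF D] by (meson Diff_subset le_less_trans)
    ultimately show ?thesis
      by (auto simp: ennreal_add_left_cancel_le add.commute)
  qed
  obtain K :: "nat \<Rightarrow> 'a set" where K: "\<And>n. compactin T (K n)" "carrier G = (\<Union>n. K n)"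
    using T(3) unfolding sigma_compact_space_def topspace_eq_carrier by blast
  \<comment> \<open>A compact exhaustion by saturated sets, so that each
    \<open>E \<inter> D n\<close> is again saturated.\<close>
  define D where "D n = ?pre ((#>) H ` (\<Union>i\<le>n. K i))" for n
  have D: "compactin T (D n)" "saturated (D n)" for n
    unfolding D_def by (auto intro!: hull compactin_Union K)
  have incD: "incseq D"
    unfolding D_def incseq_def by (auto intro: order_trans)
  have UN_D: "(\<Union>n. D n) = carrier G"
    unfolding D_def using K(2) by fastforce
  have le: "emeasure M E \<le> emeasure M (E #> g)"
    if E: "E \<in> sets M" "saturated E" and g: "g \<in> carrier G" for E g
  proof -
    have Eg: "E #> g \<in> sets M"
      using E g by (simp add: sets_radon_measure[OF M] sets_borel_of_r_coset)
    have "emeasure M E = emeasure M (\<Union>n. E \<inter> D n)"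
      using UN_D sets.sets_into_space[OF E(1)] space_M by (metis Int_UN_distrib Int_absorb2)
    also have "\<dots> = (SUP n. emeasure M (E \<inter> D n))"
    proof (rule SUP_emeasure_incseq[symmetric])
      show "range (\<lambda>n. E \<inter> D n) \<subseteq> sets M" using E D compact_sets by auto
      show "incseq (\<lambda>n. E \<inter> D n)" unfolding incseq_def using incseqD[OF incD] by blast
    qed
    also have "\<dots> \<le> emeasure M (E #> g)"
    proof (rule SUP_least)
      fix n
      have "emeasure M (E \<inter> D n) \<le> emeasure M ((E \<inter> D n) #> g)"
        using E D[of n] g compact_sets by (intro le_bounded[of _ "D n"]) (auto simp: saturated_def)
      also have "\<dots> \<le> emeasure M (E #> g)"
        using Eg by (intro emeasure_mono) (auto simp: r_coset_def)
      finally show "emeasure M (E \<inter> D n) \<le> emeasure M (E #> g)" .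
    qed
    finally show ?thesis .
  qed
  show ?thesis
  proof (intro exI[of _ M] conjI M ballI impI)
    have "emeasure M (space M) = emeasure M (?pre (topspace quotient_space))"
      by (auto simp: space_M topspace_quotient_space carrier_FactGroup
          intro!: arg_cong[where f = "emeasure M"])
    also have "\<dots> = emeasure N (space N)"
      by (simp add: opens space_radon_measure[OF N(1)])
    finally show "emeasure M (space M) \<noteq> 0" using N(2) by simp
    fix g E assume g: "g \<in> carrier G" and E: "E \<in> sets M" "saturated E"
    have "E #> g \<in> sets M"
      using E g by (simp add: sets_radon_measure[OF M] sets_borel_of_r_coset)
    then have "emeasure M (E #> g) \<le> emeasure M ((E #> g) #> inv g)"
      using E g by (intro le saturated_r_coset) auto
    also have "(E #> g) #> inv g = E"
      using E g by (intro r_coset_inv_cancel) (auto simp: saturated_def)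
    finally show "emeasure M (E #> g) = emeasure M E"
      using le[OF E g] by simp
  qed
qed

end

subsection \<open>Baire sets and Caratheodory functions\<close>

lemma borel_measurable_continuous_map:
  assumes "continuous_map X euclideanreal f" shows "f \<in> borel_measurable (borel_of X)"
proof (rule borel_measurableI)
  fix S :: "real set" assume "open S"
  then have "openin X {x \<in> topspace X. f x \<in> S}"
    using assms unfolding continuous_map_def by simp
  moreover have "{x \<in> topspace X. f x \<in> S} = f -` S \<inter> space (borel_of X)" by auto
  ultimately show "f -` S \<inter> space (borel_of X) \<in> sets (borel_of X)"
    by (metis openin_sets_borel_of)
qed

text \<open>A Caratheodory function: the second variable is approximated by nearest points of finite nets.\<close>

lemma borel_measurable_separately_continuous:
  fixes f :: "'b \<Rightarrow> 'a \<Rightarrow> real"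
  assumes X: "compact_space X" "metrizable_space X" "topspace X \<noteq> {}"
    and meas: "\<And>h. h \<in> topspace X \<Longrightarrow> (\<lambda>x. f x h) \<in> borel_measurable M"
    and cont: "\<And>x. x \<in> space M \<Longrightarrow> continuous_map X euclideanreal (f x)"
  shows "(\<lambda>(x, h). f x h) \<in> borel_measurable (M \<Otimes>\<^sub>M borel_of X)"
proof -
  obtain S d where "Metric_space S d" and Xd: "X = Metric_space.mtopology S d"
    using X(2) unfolding metrizable_space_def by blast
  then interpret Metric_space S d by simp
  have topX: "topspace X = S" by (simp add: Xd)
  have "compactin mtopology S"
    using X(1) by (simp add: Xd compact_space_def)
  then have tb: "mtotally_bounded S"
    by (rule compactin_imp_mtotally_bounded)
  have "\<exists>c::nat \<Rightarrow> 'a. (\<forall>i. c i \<in> S) \<and> (\<forall>y\<in>S. \<exists>i. y \<in> mball (c i) (inverse (Suc n)))" for n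
  proof -
    obtain K where K: "finite K" "K \<subseteq> S" "S \<subseteq> (\<Union>x\<in>K. mball x (inverse (Suc n)))"
      using tb unfolding mtotally_bounded_def
      by (metis inverse_positive_iff_positive of_nat_0_less_iff zero_less_Suc)
    then have "K \<noteq> {}" using X(3) topX by auto
    then have range: "range (from_nat_into K) = K"
      using K(1) by (intro range_from_nat_into countable_finite)
    show ?thesis
    proof (intro exI[of _ "from_nat_into K"] conjI allI ballI)
      show "from_nat_into K i \<in> S" for i
        using K(2) range by auto
      fix y assume "y \<in> S"
      then obtain x where x: "x \<in> K" "y \<in> mball x (inverse (Suc n))" using K(3) by blast
      then obtain i where "x = from_nat_into K i" using range by (metis imageE)
      then show "\<exists>i. y \<in> mball (from_nat_into K i) (inverse (Suc n))" using x by blast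
    qed
  qed
  then have "\<forall>n. \<exists>c::nat \<Rightarrow> 'a. (\<forall>i. c i \<in> S) \<and> (\<forall>y\<in>S. \<exists>i. y \<in> mball (c i) (inverse (Suc n)))"
    by blast
  then obtain c :: "nat \<Rightarrow> nat \<Rightarrow> 'a"
    where c: "\<And>n i. c n i \<in> S" "\<And>n y. y \<in> S \<Longrightarrow> \<exists>i. y \<in> mball (c n i) (inverse (Suc n))"
    unfolding choice_iff by blast
  \<comment> \<open>The first net point within distance \<open>inverse (Suc n)\<close>. Taking the
    least index makes the selection measurable with values in a countable type.\<close>
  define idx where "idx n h = (LEAST i. h \<in> mball (c n i) (inverse (Suc n)))" for n h
  have idx: "h \<in> mball (c n (idx n h)) (inverse (Suc n))" if "h \<in> S" for n h
    unfolding idx_def by (rule LeastI_ex[OF c(2)[OF that]])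
  have meas_idx: "idx n \<in> measurable (borel_of X) (count_space UNIV)" for n
    unfolding idx_def
  proof (rule measurable_Least)
    fix i
    have "mball (c n i) (inverse (Suc n)) \<in> sets (borel_of X)"
      by (intro openin_sets_borel_of) (simp add: Xd)
    moreover have "{h \<in> space (borel_of X). h \<in> mball (c n i) (inverse (Suc n))} = mball (c n i) (inverse (Suc n))"
      by (auto simp: topX)
    ultimately show "(\<lambda>h. h \<in> mball (c n i) (inverse (Suc n))) \<in> measurable (borel_of X) (count_space UNIV)"
      by (subst pred_def) simp
  qed
  show ?thesis
  proof (rule borel_measurable_LIMSEQ_real)
    fix n
    have "(\<lambda>p. f (fst p) (c n i)) \<in> borel_measurable (M \<Otimes>\<^sub>M borel_of X)" for i
      using meas[of "c n i"] c(1) topX by (intro measurable_compose[OF measurable_fst]) auto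
    moreover have "(\<lambda>p. idx n (snd p)) \<in> measurable (M \<Otimes>\<^sub>M borel_of X) (count_space UNIV)"
      by (intro measurable_compose[OF measurable_snd meas_idx])
    ultimately show "(\<lambda>p. f (fst p) (c n (idx n (snd p)))) \<in> borel_measurable (M \<Otimes>\<^sub>M borel_of X)"
      by (rule measurable_compose_countable)
  next
    fix p assume "p \<in> space (M \<Otimes>\<^sub>M borel_of X)"
    then obtain x h where p: "p = (x, h)" "x \<in> space M" "h \<in> S"
      by (auto simp: space_pair_measure topX)
    have "limitin X (\<lambda>n. c n (idx n h)) h sequentially"
      unfolding Xd limit_metric_sequentially
    proof (intro conjI allI impI p(3))
      fix e :: real assume "0 < e"
      then obtain N where N: "inverse (Suc N) < e" using reals_Archimedean by blast
      have "c n (idx n h) \<in> S \<and> d (c n (idx n h)) h < e" if "N \<le> n" for n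
      proof -
        have "d (c n (idx n h)) h < inverse (Suc n)" using idx[OF p(3), of n] by simp
        also have "\<dots> \<le> inverse (Suc N)" using that by (intro le_imp_inverse_le) auto
        finally show ?thesis using N c(1) by simp
      qed
      then show "\<exists>N. \<forall>n\<ge>N. c n (idx n h) \<in> S \<and> d (c n (idx n h)) h < e" by blast
    qed
    from continuous_map_limit[OF cont[OF p(2)] this]
    show "(\<lambda>n. f (fst p) (c n (idx n (snd p)))) \<longlonglongrightarrow> (case p of (x, h) \<Rightarrow> f x h)"
      by (simp add: p o_def)
  qed
qed

section \<open>Cozero sets\<close>

text \<open>These open sets generate the Baire sets. Membership is decided by one continuous real
  function, so the result on Caratheodory functions applies to them.\<close>

definition cozero_in :: "'a topology \<Rightarrow> 'a set \<Rightarrow> bool" where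
  "cozero_in X U \<longleftrightarrow> (\<exists>f. continuous_map X euclideanreal f \<and> U = {x \<in> topspace X. f x \<noteq> 0})"

lemma cozero_inI: "continuous_map X euclideanreal f \<Longrightarrow> cozero_in X {x \<in> topspace X. f x \<noteq> 0}"
  unfolding cozero_in_def by blast

lemma cozero_in_subset: "cozero_in X U \<Longrightarrow> U \<subseteq> topspace X"
  unfolding cozero_in_def by auto

lemma cozero_in_Int:
  assumes "cozero_in X U" "cozero_in X V" shows "cozero_in X (U \<inter> V)"
proof -
  obtain f g where fg: "continuous_map X euclideanreal f" "U = {x \<in> topspace X. f x \<noteq> 0}"
    "continuous_map X euclideanreal g" "V = {x \<in> topspace X. g x \<noteq> 0}"
    using assms unfolding cozero_in_def by blast
  then have "cozero_in X {x \<in> topspace X. f x * g x \<noteq> 0}"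
    by (intro cozero_inI continuous_map_real_mult)
  moreover have "{x \<in> topspace X. f x * g x \<noteq> 0} = U \<inter> V" using fg by auto
  ultimately show ?thesis by simp
qed

lemma cozero_in_Un:
  assumes "cozero_in X U" "cozero_in X V" shows "cozero_in X (U \<union> V)"
proof -
  obtain f g where fg: "continuous_map X euclideanreal f" "U = {x \<in> topspace X. f x \<noteq> 0}"
    "continuous_map X euclideanreal g" "V = {x \<in> topspace X. g x \<noteq> 0}"
    using assms unfolding cozero_in_def by blast
  then have "cozero_in X {x \<in> topspace X. f x * f x + g x * g x \<noteq> 0}"
    by (intro cozero_inI continuous_map_add continuous_map_real_mult)
  moreover have "{x \<in> topspace X. f x * f x + g x * g x \<noteq> 0} = U \<union> V"
    using fg by (auto simp: sum_squares_eq_zero_iff)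
  ultimately show ?thesis by simp
qed

lemma cozero_in_preimage:
  assumes "continuous_map X Y f" "cozero_in Y U" shows "cozero_in X {x \<in> topspace X. f x \<in> U}"
proof -
  obtain g where g: "continuous_map Y euclideanreal g" "U = {x \<in> topspace Y. g x \<noteq> 0}"
    using assms unfolding cozero_in_def by blast
  then have "cozero_in X {x \<in> topspace X. (g \<circ> f) x \<noteq> 0}"
    using assms by (intro cozero_inI continuous_map_compose)
  moreover have "{x \<in> topspace X. (g \<circ> f) x \<noteq> 0} = {x \<in> topspace X. f x \<in> U}"
    using g assms by (auto simp: continuous_map_def)
  ultimately show ?thesis by simp
qed

text \<open>The positive and negative parts of one Urysohn function with values 1 on
  \<open>K\<close> and -1 on \<open>L\<close> have disjoint cozero sets.\<close>

lemma cozero_in_separation: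
  assumes X: "locally_compact_space X" "Hausdorff_space X"
    and K: "compactin X K" and L: "closedin X L" "disjnt K L"
  obtains U V where "cozero_in X U" "cozero_in X V" "K \<subseteq> U" "L \<subseteq> V" "disjnt U V"
proof -
  have "completely_regular_space X"
    using X by (simp add: locally_compact_regular_imp_completely_regular_space)
  then obtain f where f: "continuous_map X euclideanreal f" "f ` L \<subseteq> {- 1}" "f ` K \<subseteq> {1}"
    using Urysohn_completely_regular_compact_closed_alt[OF _ K L] by metis
  show thesis
  proof
    show "cozero_in X {x \<in> topspace X. max (f x) 0 \<noteq> 0}" "cozero_in X {x \<in> topspace X. min (f x) 0 \<noteq> 0}"
      using f(1) by (intro cozero_inI continuous_map_real_max continuous_map_real_min; simp)+
  qed (use f compactin_subset_topspace[OF K] closedin_subset[OF L(1)] in \<open>auto simp: disjnt_iff\<close>)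
qed

section \<open>Infima and scaling in \<open>ennreal\<close>\<close>

lemma le_INF_add_INF_ennreal:
  fixes f g :: "_ \<Rightarrow> ennreal"
  assumes le: "\<And>x y. x \<in> A \<Longrightarrow> y \<in> B \<Longrightarrow> c \<le> f x + g y"
  shows "c \<le> (INF x\<in>A. f x) + (INF y\<in>B. g y)"
proof (rule ennreal_le_epsilon)
  fix e :: real assume e: "0 < e" and fin: "(INF x\<in>A. f x) + (INF y\<in>B. g y) < top_class.top"
  have "x < x + ennreal (e / 2)" if "x < top_class.top" for x :: ennreal
    using that e by (auto simp: less_top)
  then have "(INF x\<in>A. f x) < (INF x\<in>A. f x) + ennreal (e / 2)" "(INF y\<in>B. g y) < (INF y\<in>B. g y) + ennreal (e / 2)"
    using fin by (simp_all only: ennreal_add_less_top)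
  then obtain x y where "x \<in> A" "y \<in> B"
    and "f x < (INF x\<in>A. f x) + ennreal (e / 2)" "g y < (INF y\<in>B. g y) + ennreal (e / 2)"
    unfolding INF_less_iff by blast
  then have "c \<le> ((INF x\<in>A. f x) + ennreal (e / 2)) + ((INF y\<in>B. g y) + ennreal (e / 2))"
    using le by (meson add_mono less_imp_le order_trans)
  also have "\<dots> = (INF x\<in>A. f x) + (INF y\<in>B. g y) + (ennreal (e / 2) + ennreal (e / 2))"
    by (simp add: ac_simps)
  also have "ennreal (e / 2) + ennreal (e / 2) = ennreal e"
    using e by (simp flip: ennreal_plus)
  finally show "c \<le> (INF x\<in>A. f x) + (INF y\<in>B. g y) + ennreal e" .
qed

text \<open>Multiplication by \<open>ennreal r\<close> has the inverse
  \<open>ennreal (1 / r)\<close>, so the easy inequality applied to \<open>1 / r\<close> yields the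
  converse.\<close>

lemma ennreal_mult_INF:
  fixes f :: "_ \<Rightarrow> ennreal"
  assumes r: "0 < r"
  shows "ennreal r * (INF x\<in>A. f x) = (INF x\<in>A. ennreal r * f x)"
proof (rule antisym)
  have *: "ennreal s * (INF x\<in>A. g x) \<le> (INF x\<in>A. ennreal s * g x)" for s and g :: "_ \<Rightarrow> ennreal"
    by (intro INF_greatest mult_left_mono INF_lower) auto
  show "ennreal r * (INF x\<in>A. f x) \<le> (INF x\<in>A. ennreal r * f x)" by (rule *)
  have one: "ennreal (1 / r) * ennreal r = 1" "ennreal r * ennreal (1 / r) = 1"
    using r by (simp_all flip: ennreal_mult')
  have "ennreal (1 / r) * (INF x\<in>A. ennreal r * f x) \<le> (INF x\<in>A. f x)"
    using *[of "1 / r" "\<lambda>x. ennreal r * f x"] by (simp add: one flip: mult.assoc)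
  then have "ennreal r * (ennreal (1 / r) * (INF x\<in>A. ennreal r * f x)) \<le> ennreal r * (INF x\<in>A. f x)"
    by (rule mult_left_mono) simp
  then show "(INF x\<in>A. ennreal r * f x) \<le> ennreal r * (INF x\<in>A. f x)"
    by (simp add: one flip: mult.assoc)
qed

lemma radon_measure_scale_measure:
  assumes M: "radon_measure X M" and r: "0 < r"
  shows "radon_measure X (scale_measure (ennreal r) M)"
  unfolding radon_measure_def space_scale_measure sets_scale_measure emeasure_scale_measure
    ennreal_mult_INF[OF r, symmetric] SUP_mult_left_ennreal[symmetric]
proof (intro conjI allI impI ballI)
  show "space M = topspace X" "sets M = sets (borel_of X)"
    by (rule space_radon_measure[OF M] sets_radon_measure[OF M])+
  fix K assume "compactin X K"
  from emeasure_compactin_finite[OF M this] show "ennreal r * emeasure M K < \<infinity>"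
    by (simp add: ennreal_mult_less_top)
next
  fix E assume "E \<in> sets M"
  then have "emeasure M E = (INF U\<in>{U. openin X U \<and> E \<subseteq> U}. emeasure M U)"
    using M unfolding radon_measure_def by blast
  then show "ennreal r * emeasure M E = ennreal r * (INF U\<in>{U. openin X U \<and> E \<subseteq> U}. emeasure M U)"
    by (rule arg_cong)
next
  fix U assume "openin X U"
  then have "emeasure M U = (SUP K\<in>{K. compactin X K \<and> K \<subseteq> U}. emeasure M K)"
    using M unfolding radon_measure_def by blast
  then show "ennreal r * emeasure M U = ennreal r * (SUP K\<in>{K. compactin X K \<and> K \<subseteq> U}. emeasure M K)"
    by (rule arg_cong)
qed

lemma (in right_topological_group) right_haar_measure_normalize:
  assumes M: "radon_measure T M" "emeasure M (space M) \<noteq> 0"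
    and inv: "\<And>g E. g \<in> carrier G \<Longrightarrow> E \<in> sets M \<Longrightarrow> emeasure M (E #> g) = emeasure M E"
  shows "\<exists>M. right_haar_measure G T M"
proof (cases "compact_space T")
  case False
  then show ?thesis
    using assms unfolding right_haar_measure_def by (intro exI[of _ M]) blast
next
  case True
  then have "emeasure M (space M) < \<infinity>"
    using M(1) by (auto simp: radon_measure_def compact_space_def)
  then obtain c where c: "emeasure M (space M) = ennreal c" "0 \<le> c"
    by (cases "emeasure M (space M)") auto
  then have "0 < c" using M(2) by (cases "c = 0") auto
  then have "ennreal (1 / c) * ennreal c = 1" by (simp flip: ennreal_mult')
  then have "right_haar_measure G T (scale_measure (ennreal (1 / c)) M)"
    unfolding right_haar_measure_def
    using c \<open>0 < c\<close> inv by (auto simp: space_scale_measure intro: radon_measure_scale_measure[OF M(1)])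
  then show ?thesis ..
qed

section \<open>Integrals of functions constant on cosets\<close>

context right_topological_group_normal
begin

text \<open>The saturated Borel sets form a \<sigma>-algebra for which \<open>\<phi>\<close> is
  measurable. On it the identity and the translation push \<open>M\<close> forward to the same
  measure.\<close>

lemma nn_integral_saturated_translate:
  assumes M: "sets M = sets (borel_of T)"
    and inv: "\<And>E g. E \<in> sets M \<Longrightarrow> saturated E \<Longrightarrow> g \<in> carrier G \<Longrightarrow> emeasure M (E #> g) = emeasure M E"
    and \<phi>: "\<phi> \<in> borel_measurable M"
    and \<phi>_inv: "\<And>h x. h \<in> H \<Longrightarrow> x \<in> carrier G \<Longrightarrow> \<phi> (h \<otimes> x) = \<phi> x"
    and g: "g \<in> carrier G"
  shows "(\<integral>\<^sup>+x. \<phi> (x \<otimes> inv g) \<partial>M) = (\<integral>\<^sup>+x. \<phi> x \<partial>M)"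
proof -
  have sp: "space M = carrier G"
    using sets_eq_imp_space_eq[OF M] by (simp add: topspace_eq_carrier)
  define \<S> where "\<S> = {E \<in> sets M. saturated E}"
  have sub: "E \<subseteq> carrier G" if "E \<in> \<S>" for E
    using that by (auto simp: \<S>_def saturated_def)
  interpret \<S>: sigma_algebra "carrier G" \<S>
    unfolding sigma_algebra_iff2
  proof (intro conjI ballI allI impI)
    show "\<S> \<subseteq> Pow (carrier G)" using sub by auto
    show "{} \<in> \<S>" by (simp add: \<S>_def saturated_def)
    fix E assume "E \<in> \<S>"
    then have E: "E \<in> sets M" "saturated E" by (auto simp: \<S>_def)
    have "h \<otimes> x \<notin> E" if "h \<in> H" "x \<in> carrier G" "x \<notin> E" for h x
    proof
      assume "h \<otimes> x \<in> E"
      then have "inv h \<otimes> (h \<otimes> x) \<in> E" using E(2) that by (auto simp: saturated_def)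
      then show False using that subset by (simp add: subsetD flip: m_assoc)
    qed
    then have "saturated (carrier G - E)"
      using subset by (auto simp: saturated_def)
    then show "carrier G - E \<in> \<S>"
      using E sets.compl_sets[of E M] by (simp add: \<S>_def sp)
  next
    fix A :: "nat \<Rightarrow> 'a set" assume "range A \<subseteq> \<S>"
    then show "\<Union>(range A) \<in> \<S>" unfolding \<S>_def saturated_def by blast
  qed
  define S where "S = sigma (carrier G) \<S>"
  have S: "sets S = \<S>" "space S = carrier G"
    by (simp_all add: S_def \<S>.space_closed)
  have id: "(\<lambda>x. x) \<in> measurable M S"
  proof (rule measurableI)
    fix A assume "A \<in> sets S"
    then show "(\<lambda>x. x) -` A \<inter> space M \<in> sets M"
      using sets.sets_into_space[of A M] by (auto simp: S \<S>_def Int_absorb2)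
  qed (simp add: S sp)
  have pre: "(\<lambda>x. x \<otimes> inv g) -` A \<inter> space M = A #> g" if "A \<subseteq> carrier G" for A
    using that g by (auto simp: sp r_coset_eq_preimage)
  have tr: "(\<lambda>x. x \<otimes> inv g) \<in> measurable M S"
  proof (rule measurableI)
    fix A assume "A \<in> sets S"
    then have "A \<in> sets M" "A \<subseteq> carrier G" using sub by (auto simp: S \<S>_def)
    then show "(\<lambda>x. x \<otimes> inv g) -` A \<inter> space M \<in> sets M"
      using g by (simp add: pre M sets_borel_of_r_coset)
  qed (use g in \<open>simp add: S sp\<close>)
  have \<phi>S: "\<phi> \<in> borel_measurable S"
  proof (rule measurableI)
    fix B :: "ennreal set" assume B: "B \<in> sets borel"
    have "\<phi> -` B \<inter> space M \<in> sets M" using \<phi> B by (rule measurable_sets)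
    moreover have "saturated (\<phi> -` B \<inter> carrier G)"
      using \<phi>_inv subset by (auto simp: saturated_def)
    ultimately show "\<phi> -` B \<inter> space S \<in> sets S"
      by (simp add: S sp \<S>_def)
  qed simp
  have "distr M S (\<lambda>x. x) = distr M S (\<lambda>x. x \<otimes> inv g)"
  proof (rule measure_eqI)
    fix A assume "A \<in> sets (distr M S (\<lambda>x. x))"
    then have A: "A \<in> sets S" by simp
    then have A': "A \<in> sets M" "saturated A" "A \<subseteq> carrier G" using sub by (auto simp: S \<S>_def)
    have "emeasure (distr M S (\<lambda>x. x)) A = emeasure M A"
      using A A' id by (simp add: emeasure_distr sp Int_absorb2)
    also have "\<dots> = emeasure (distr M S (\<lambda>x. x \<otimes> inv g)) A"
      using A A' tr g by (simp add: emeasure_distr pre inv)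
    finally show "emeasure (distr M S (\<lambda>x. x)) A = emeasure (distr M S (\<lambda>x. x \<otimes> inv g)) A" .
  qed simp
  then show ?thesis
    using nn_integral_distr[OF id, of \<phi>] nn_integral_distr[OF tr, of \<phi>] \<phi>S by simp
qed

end

subsection \<open>Existence of Haar measure\<close>

context right_topological_group_normal
begin

theorem ex_right_haar_measure:
  assumes T: "locally_compact_space T" "Hausdorff_space T" "sigma_compact_space T"
    and Q: "locally_compact_topological_group (G Mod H) quotient_space"
    and H: "compactin T H" "metrizable_space (subtopology T H)" "H \<subseteq> borel_center G T"
    and L: "right_haar_measure (G\<lparr>carrier := H\<rparr>) (subtopology T H) L"
  shows "\<exists>M. right_haar_measure G T M"
proof -
  let ?TH = "subtopology T H"
  have Q_Hausdorff: "Hausdorff_space quotient_space"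
    using Q by (rule locally_compact_topological_group.Hausdorff)
  have top_H: "topspace ?TH = H"
    using subset topspace_eq_carrier by auto
  have ne_H: "topspace ?TH \<noteq> {}"
    using subgroup.one_closed[OF subgroup_axioms] unfolding top_H by blast
  have comp_H: "compact_space ?TH"
    using H(1) by (rule compact_space_subtopology)
  have L_radon: "radon_measure ?TH L" and L_space: "emeasure L (space L) = 1"
    and L_inv: "\<And>h E. h \<in> H \<Longrightarrow> E \<in> sets L \<Longrightarrow> emeasure L (E #> h) = emeasure L E"
    using L comp_H by (simp_all add: right_haar_measure_def)
  have space_L: "space L = H" and sets_L: "sets L = sets (borel_of ?TH)"
    using space_radon_measure[OF L_radon] sets_radon_measure[OF L_radon] unfolding top_H by auto
  have L_H: "emeasure L H = 1"
    using L_space by (simp add: space_L)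
  interpret L: finite_measure L
    by (rule finite_measureI) (simp add: space_L L_H)
  obtain \<mu> where \<mu>: "radon_measure T \<mu>" "emeasure \<mu> (space \<mu>) \<noteq> 0"
    and \<mu>_inv: "\<And>E g. E \<in> sets \<mu> \<Longrightarrow> saturated E \<Longrightarrow> g \<in> carrier G \<Longrightarrow> emeasure \<mu> (E #> g) = emeasure \<mu> E"
    using ex_radon_measure_saturated_invariant[OF T Q H(1)] by blast
  have sets_\<mu>: "sets \<mu> = sets (borel_of T)" and space_\<mu>: "space \<mu> = carrier G"
    using sets_radon_measure[OF \<mu>(1)] space_radon_measure[OF \<mu>(1)] by (simp_all add: topspace_eq_carrier)
  have compact_sets: "K \<in> sets \<mu>" if "compactin T K" for K
    using that T(2) by (simp add: sets_\<mu> compactin_sets_borel_of)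

  \<comment> \<open>The preimage of \<open>U\<close> under
    \<open>(x, h) \<mapsto> h \<otimes> x\<close>, so that \<open>m\<close> below is the
    push-forward of the product measure.\<close>
  define P where "P U = {p \<in> carrier G \<times> H. snd p \<otimes> fst p \<in> U}" for U
  have P_sets: "P U \<in> sets (\<mu> \<Otimes>\<^sub>M L)" if U: "cozero_in T U" for U
  proof -
    obtain f where f: "continuous_map T euclideanreal f" "U = {x \<in> topspace T. f x \<noteq> 0}"
      using U unfolding cozero_in_def by blast
    \<comment> \<open>Measurability in \<open>x\<close> is the hypothesis on the Borel center;
      continuity in \<open>h\<close> is continuity of right translation by \<open>x\<close>.\<close>
    have "(\<lambda>(x, h). f (h \<otimes> x)) \<in> borel_measurable (\<mu> \<Otimes>\<^sub>M borel_of ?TH)"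
    proof (rule borel_measurable_separately_continuous)
      fix h assume "h \<in> topspace ?TH"
      then have "(\<lambda>x. h \<otimes> x) \<in> measurable (borel_of T) (borel_of T)"
        using H(3) top_H by (auto simp: borel_center_def)
      then have "(\<lambda>x. h \<otimes> x) \<in> measurable \<mu> (borel_of T)"
        using measurable_cong_sets[OF sets_\<mu> refl] by blast
      then show "(\<lambda>x. f (h \<otimes> x)) \<in> borel_measurable \<mu>"
        using borel_measurable_continuous_map[OF f(1)] by (rule measurable_compose)
    next
      fix x assume "x \<in> space \<mu>"
      then have "continuous_map ?TH T (\<lambda>h. h \<otimes> x)"
        by (intro continuous_map_from_subtopology continuous_right_mult) (simp add: space_\<mu>)
      from continuous_map_compose[OF this f(1)]
      show "continuous_map ?TH euclideanreal (\<lambda>h. f (h \<otimes> x))" by (simp add: o_def)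
    qed (rule comp_H H(2) ne_H)+
    then have "(\<lambda>(x, h). f (h \<otimes> x)) -` (- {0}) \<inter> space (\<mu> \<Otimes>\<^sub>M borel_of ?TH) \<in> sets (\<mu> \<Otimes>\<^sub>M borel_of ?TH)"
      by (rule measurable_sets) simp
    moreover have "(\<lambda>(x, h). f (h \<otimes> x)) -` (- {0}) \<inter> space (\<mu> \<Otimes>\<^sub>M borel_of ?TH) = P U"
      using subset by (auto simp: P_def f(2) space_pair_measure space_\<mu> top_H topspace_eq_carrier)
    moreover have "sets (\<mu> \<Otimes>\<^sub>M borel_of ?TH) = sets (\<mu> \<Otimes>\<^sub>M L)"
      by (rule sets_pair_measure_cong) (simp_all add: sets_L)
    ultimately show ?thesis by simp
  qed
  define \<phi> where "\<phi> U x = emeasure L (Pair x -` P U)" for U x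
  have Pair_vimage_P: "Pair x -` P U = {h \<in> H. h \<otimes> x \<in> U}" if "x \<in> carrier G" for x U
    using that by (auto simp: P_def)
  define m where "m U = emeasure (\<mu> \<Otimes>\<^sub>M L) (P U)" for U
  have m_eq: "m U = (\<integral>\<^sup>+x. \<phi> U x \<partial>\<mu>)" if "cozero_in T U" for U
    unfolding m_def \<phi>_def by (rule L.emeasure_pair_measure_alt[OF P_sets[OF that]])
  have m_mono: "m U \<le> m V" if "U \<subseteq> V" "cozero_in T V" for U V
    unfolding m_def using that by (intro emeasure_mono P_sets) (auto simp: P_def)
  have P_Un: "P (U \<union> V) = P U \<union> P V" for U V by (auto simp: P_def)
  \<comment> \<open>Since \<open>h \<otimes> (k \<otimes> x) = (h \<otimes> k) \<otimes> x\<close>,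
    replacing \<open>x\<close> by \<open>k \<otimes> x\<close> translates the section on the right
    by \<open>inv k\<close>, and \<open>L\<close> is right invariant.\<close>
  have \<phi>_inv: "\<phi> U (k \<otimes> x) = \<phi> U x" if U: "cozero_in T U" and k: "k \<in> H" and x: "x \<in> carrier G" for U k x
  proof -
    let ?E = "{h \<in> H. h \<otimes> x \<in> U}"
    have kc: "k \<in> carrier G" using k subset by auto
    have E: "?E \<in> sets L"
      using sets_Pair1[OF P_sets[OF U], of x] x by (simp add: Pair_vimage_P)
    have "{h \<in> H. h \<otimes> (k \<otimes> x) \<in> U} = ?E #> inv k"
    proof (intro equalityI subsetI)
      fix h assume h: "h \<in> {h \<in> H. h \<otimes> (k \<otimes> x) \<in> U}"
      then have hc: "h \<in> carrier G" using subset by auto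
      have "h \<otimes> k \<in> ?E" using h hc k kc x by (simp add: m_assoc)
      moreover have "h = (h \<otimes> k) \<otimes> inv k" using hc kc by (simp add: m_assoc)
      ultimately show "h \<in> ?E #> inv k" unfolding r_coset_eq_image by (rule rev_image_eqI)
    next
      fix h assume "h \<in> ?E #> inv k"
      then obtain e where e: "e \<in> H" "e \<otimes> x \<in> U" "h = e \<otimes> inv k" by (auto simp: r_coset_def)
      then have ec: "e \<in> carrier G" using subset by auto
      have "h \<otimes> (k \<otimes> x) = e \<otimes> (inv k \<otimes> (k \<otimes> x))" using e ec kc x by (simp add: m_assoc)
      also have "inv k \<otimes> (k \<otimes> x) = x" using kc x by (simp flip: m_assoc)
      finally show "h \<in> {h \<in> H. h \<otimes> (k \<otimes> x) \<in> U}" using e k by simp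
    qed
    then show ?thesis
      using E k kc x by (simp add: \<phi>_def Pair_vimage_P L_inv)
  qed
  have cozero_r_coset: "cozero_in T (U #> g)" if U: "cozero_in T U" and g: "g \<in> carrier G" for U g
    using cozero_in_preimage[OF continuous_right_mult[of "inv g"] U] cozero_in_subset[OF U] g
    by (simp add: r_coset_eq_preimage topspace_eq_carrier)
  \<comment> \<open>Translating \<open>U\<close> by \<open>g\<close> replaces
    \<open>\<phi> U x\<close> by \<open>\<phi> U (x \<otimes> inv g)\<close>. As
    \<open>\<phi> U\<close> is constant on cosets, invariance of \<open>\<mu>\<close> on saturated
    sets is enough.\<close>
  have m_r_coset: "m (U #> g) = m U" if U: "cozero_in T U" and g: "g \<in> carrier G" for U g
  proof -
    have Uc: "U \<subseteq> carrier G" using cozero_in_subset[OF U] by (simp add: topspace_eq_carrier)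
    have "\<phi> (U #> g) x = \<phi> U (x \<otimes> inv g)" if x: "x \<in> carrier G" for x
    proof -
      have "h \<otimes> x \<in> U #> g \<longleftrightarrow> h \<otimes> (x \<otimes> inv g) \<in> U" if "h \<in> H" for h
        using that x g subset by (simp add: r_coset_eq_preimage[OF Uc g] subsetD m_assoc)
      then show ?thesis
        using x g by (auto simp: \<phi>_def Pair_vimage_P intro!: arg_cong[where f = "emeasure L"])
    qed
    then have "m (U #> g) = (\<integral>\<^sup>+x. \<phi> U (x \<otimes> inv g) \<partial>\<mu>)"
      unfolding m_eq[OF cozero_r_coset[OF U g]] by (intro nn_integral_cong) (simp add: space_\<mu>)
    also have "\<dots> = (\<integral>\<^sup>+x. \<phi> U x \<partial>\<mu>)"
    proof (rule nn_integral_saturated_translate[OF sets_\<mu> \<mu>_inv _ _ g])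
      show "\<phi> U \<in> borel_measurable \<mu>"
        unfolding \<phi>_def by (rule L.measurable_emeasure_Pair[OF P_sets[OF U]])
    qed (use \<phi>_inv[OF U] in auto)
    finally show ?thesis by (simp add: m_eq[OF U])
  qed
  define sat where "sat C = {x \<in> carrier G. H #> x \<in> (#>) H ` C}" for C
  have sat: "compactin T (sat C)" "saturated (sat C)" "C \<subseteq> sat C" if C: "compactin T C" for C
  proof -
    have "compactin quotient_space ((#>) H ` C)"
      using C quotient_imp_continuous_map[OF quotient_map_quotient_space] by (rule image_compactin)
    then show "compactin T (sat C)"
      unfolding sat_def by (rule compactin_quotient_preimage[OF T Q_Hausdorff H(1)])
    show "saturated (sat C)" unfolding sat_def by (rule saturated_preimage)
    show "C \<subseteq> sat C" using compactin_subset_topspace[OF C] by (auto simp: sat_def topspace_eq_carrier)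
  qed

  \<comment> \<open>Cozero sets are a base at compact sets, so this infimum transfers the Baire
    push-forward to a content.\<close>
  define a where "a K = (INF U\<in>{U. cozero_in T U \<and> K \<subseteq> U}. m U)" for K
  have a_le: "a K \<le> m U" if "cozero_in T U" "K \<subseteq> U" for K U
    unfolding a_def using that by (intro INF_lower) auto
  have a_r_coset_le: "a (K #> g) \<le> a K" if "compactin T K" and g: "g \<in> carrier G" for K g
    unfolding a_def[of K]
  proof (rule INF_greatest)
    fix U assume U: "U \<in> {U. cozero_in T U \<and> K \<subseteq> U}"
    then have "a (K #> g) \<le> m (U #> g)"
      using g by (intro a_le cozero_r_coset) (auto simp: r_coset_def)
    then show "a (K #> g) \<le> m U"
      using U g by (simp add: m_r_coset)
  qed
  interpret right_invariant_content G T a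
  proof unfold_locales
    show "locally_compact_space T" "Hausdorff_space T" by (rule T)+
  next
    fix K assume K: "compactin T K"
    \<comment> \<open>A cozero neighbourhood \<open>U\<close> of \<open>K\<close> inside a compact
      \<open>C\<close> has \<open>\<phi> U\<close> at most 1 everywhere and 0 off the compact set
      \<open>sat C\<close>.\<close>
    have "\<exists>V C. openin T V \<and> compactin T C \<and> K \<subseteq> V \<and> V \<subseteq> C"
      using T K locally_compact_space_compact_closed_compact[of T] by metis
    then obtain V C where VC: "openin T V" "compactin T C" "K \<subseteq> V" "V \<subseteq> C" by blast
    have "closedin T (topspace T - V)" "disjnt K (topspace T - V)"
      using VC by (auto simp: disjnt_def)
    then obtain U W where U: "cozero_in T U" "K \<subseteq> U" and W: "topspace T - V \<subseteq> W" "disjnt U W"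
      using cozero_in_separation[OF T(1,2) K] by metis
    have UC: "U \<subseteq> C"
      using W VC(4) cozero_in_subset[OF U(1)] by (auto simp: disjnt_iff)
    have "m U = (\<integral>\<^sup>+x. \<phi> U x \<partial>\<mu>)" by (rule m_eq[OF U(1)])
    also have "\<dots> \<le> (\<integral>\<^sup>+x. indicator (sat C) x \<partial>\<mu>)"
    proof (rule nn_integral_mono)
      fix x assume "x \<in> space \<mu>"
      then have x: "x \<in> carrier G" by (simp add: space_\<mu>)
      show "\<phi> U x \<le> indicator (sat C) x"
      proof (cases "x \<in> sat C")
        case True
        have "\<phi> U x \<le> emeasure L (space L)" unfolding \<phi>_def by (rule emeasure_space)
        then show ?thesis using True by (simp add: space_L L_H)
      next
        case False
        have "h \<otimes> x \<notin> U" if "h \<in> H" for h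
        proof
          assume "h \<otimes> x \<in> U"
          then have "H #> (h \<otimes> x) \<in> (#>) H ` C" using UC by auto
          then show False using False that x by (simp add: sat_def r_coset_left_mult)
        qed
        then have "Pair x -` P U = {}" using x by (auto simp: Pair_vimage_P)
        then show ?thesis by (simp add: \<phi>_def)
      qed
    qed
    also have "\<dots> = emeasure \<mu> (sat C)"
      using sat[OF VC(2)] compact_sets by simp
    also have "\<dots> < \<infinity>"
      using sat[OF VC(2)] by (intro emeasure_compactin_finite[OF \<mu>(1)])
    finally show "a K < \<infinity>" using a_le[OF U] by (rule le_less_trans[rotated])
  next
    fix K L' :: "'a set" assume "K \<subseteq> L'"
    then show "a K \<le> a L'" unfolding a_def by (intro INF_superset_mono) auto
  next
    fix K K' :: "'a set"
    show "a (K \<union> K') \<le> a K + a K'"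
      unfolding a_def[of K] a_def[of K']
    proof (rule le_INF_add_INF_ennreal)
      fix U V assume UV: "U \<in> {U. cozero_in T U \<and> K \<subseteq> U}" "V \<in> {U. cozero_in T U \<and> K' \<subseteq> U}"
      then have "a (K \<union> K') \<le> m (U \<union> V)" by (intro a_le cozero_in_Un) auto
      also have "\<dots> \<le> m U + m V"
        unfolding m_def P_Un using UV by (intro emeasure_subadditive P_sets) auto
      finally show "a (K \<union> K') \<le> m U + m V" .
    qed
  next
    fix K K' assume K: "compactin T K" "compactin T K'" "disjnt K K'"
    then obtain V W where VW: "cozero_in T V" "cozero_in T W" "K \<subseteq> V" "K' \<subseteq> W" "disjnt V W"
      using cozero_in_separation[OF T(1,2) K(1) compactin_imp_closedin[OF T(2) K(2)]] by metis
    show "a K + a K' \<le> a (K \<union> K')"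
      unfolding a_def[of "K \<union> K'"]
    proof (rule INF_greatest)
      fix U assume U: "U \<in> {U. cozero_in T U \<and> K \<union> K' \<subseteq> U}"
      \<comment> \<open>Cutting \<open>U\<close> by the separating sets gives disjoint cozero
        pieces, on which \<open>m\<close> is additive.\<close>
      have cz: "cozero_in T (U \<inter> V)" "cozero_in T (U \<inter> W)"
        using U VW by (auto intro: cozero_in_Int)
      have "a K + a K' \<le> m (U \<inter> V) + m (U \<inter> W)"
        using U VW cz by (intro add_mono a_le) auto
      also have "\<dots> = m ((U \<inter> V) \<union> (U \<inter> W))"
        unfolding m_def P_Un
        using VW(5) by (intro plus_emeasure P_sets cz) (auto simp: P_def disjnt_iff)
      also have "\<dots> \<le> m U"
        using U by (intro m_mono) auto
      finally show "a K + a K' \<le> m U" .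
    qed
  next
    fix K g assume K: "compactin T K" and g: "g \<in> carrier G"
    have "a ((K #> g) #> inv g) \<le> a (K #> g)"
      using K g by (intro a_r_coset_le compactin_r_coset) auto
    moreover have "(K #> g) #> inv g = K"
      using compactin_subset_topspace[OF K] g by (intro r_coset_inv_cancel) (auto simp: topspace_eq_carrier)
    ultimately show "a (K #> g) = a K"
      using a_r_coset_le[OF K g] by simp
  qed
  \<comment> \<open>For nontriviality: if \<open>U\<close> contains the saturated set
    \<open>sat K\<close>, then \<open>\<phi> U\<close> is 1 on it because \<open>L\<close> is a
    probability measure, so \<open>m U\<close> is at least the \<mu>-measure of
    \<open>sat K\<close>.\<close>
  have \<mu>_le: "emeasure \<mu> K \<le> emeasure content_measure (space content_measure)" if K: "compactin T K" for K
  proof -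
    have "emeasure \<mu> K \<le> emeasure \<mu> (sat K)"
      using sat[OF K] compact_sets by (intro emeasure_mono) auto
    also have "\<dots> \<le> a (sat K)"
      unfolding a_def
    proof (rule INF_greatest)
      fix U assume U: "U \<in> {U. cozero_in T U \<and> sat K \<subseteq> U}"
      have "emeasure \<mu> (sat K) = (\<integral>\<^sup>+x. indicator (sat K) x \<partial>\<mu>)"
        using sat[OF K] compact_sets by simp
      also have "\<dots> \<le> (\<integral>\<^sup>+x. \<phi> U x \<partial>\<mu>)"
      proof (rule nn_integral_mono)
        fix x assume "x \<in> space \<mu>"
        show "indicator (sat K) x \<le> \<phi> U x"
        proof (cases "x \<in> sat K")
          case True
          then have "Pair x -` P U = H"
            using U sat(2)[OF K] by (auto simp: P_def saturated_def)
          then show ?thesis using True by (simp add: \<phi>_def L_H)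
        qed simp
      qed
      finally show "emeasure \<mu> (sat K) \<le> m U" using U by (simp add: m_eq)
    qed
    also have "\<dots> \<le> emeasure content_measure (sat K)"
      by (rule content_le_emeasure[OF sat(1)[OF K]])
    also have "\<dots> \<le> emeasure content_measure (space content_measure)"
      by (rule emeasure_space)
    finally show ?thesis .
  qed
  have "emeasure \<mu> (space \<mu>) = (SUP K\<in>{K. compactin T K \<and> K \<subseteq> topspace T}. emeasure \<mu> K)"
    using \<mu>(1) openin_topspace[of T] unfolding radon_measure_def by metis
  also have "\<dots> \<le> emeasure content_measure (space content_measure)"
    by (rule SUP_least) (auto intro: \<mu>_le)
  finally have "emeasure content_measure (space content_measure) \<noteq> 0"
    using \<mu>(2) by auto
  then show ?thesis
    using radon_measure_content_measure emeasure_content_measure_r_coset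
    by (intro right_haar_measure_normalize[of content_measure])
qed

end

theorem proposition4p16:
  fixes G :: "('a, 'b) monoid_scheme" and T :: "'a topology" and H :: "'a set"
  assumes "right_topological_group G T"
    and "Hausdorff_space T"
    and "(sigma_locally_compact_space T \<and> admissible G T) \<or> compact_space T"
    and "H \<lhd> G"
    and "closedin (sigma_sigma_topology G T) H"
    and "compactin T H"
    and "H \<subseteq> borel_center G T"
    and "metrizable_space (subtopology T H)"
    and "\<exists>M. right_haar_measure (G\<lparr>carrier := H\<rparr>) (subtopology T H) M"
  shows "\<exists>M. right_haar_measure G T M"
proof -
  interpret right_topological_group_normal G T H
    by (rule right_topological_group_normal.intro[OF assms(1,4)])
  have T: "locally_compact_space T" "sigma_compact_space T" "admissible G T \<or> compact_space T"
  proof -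
    \<comment> \<open>In both cases \<open>T\<close> is locally compact and \<sigma>-compact; the
      alternative survives only in how local compactness of the \<sigma>-quotient is proved.\<close>
    have "sigma_compact_space T" if "compact_space T"
      unfolding sigma_compact_space_def
      using that by (intro exI[of _ "\<lambda>n. topspace T"]) (simp add: compact_space_def)
    then show "locally_compact_space T" "sigma_compact_space T" "admissible G T \<or> compact_space T"
      using assms(2,3) compact_imp_locally_compact_space[of T]
      by (auto simp: sigma_locally_compact_space_def)
  qed
  have "locally_compact_topological_group (G Mod H) quotient_space"
    by (rule locally_compact_topological_group_quotient_space[OF T assms(5)])
  moreover obtain L where "right_haar_measure (G\<lparr>carrier := H\<rparr>) (subtopology T H) L"
    using assms(9) by blast
  ultimately show ?thesis
    by (rule ex_right_haar_measure[OF T(1) assms(2) T(2) _ assms(6,8,7)])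
qed

end
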